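(* Let $T$ be a regular $k$-rotation of $\mathbb E^n$ with rotation angles $\Theta=\{\theta_1,\dots,\theta_k\}$, $0<\theta_i\le\pi$, $\theta_i\neq\theta_j$ for $i\neq j$. Let $\mathcal O_{k,\Theta}(n)$ denote the conjugacy class of $T$ in $O(n)$. (i) When $n=2k$, the conjugacy class $\mathcal O_{k,\Theta}(2k)$ is a $d_0(k)$-sheeted covering space over $\mathcal D(2;k)$, where $d_0(k)=2^k k!$ if $T$ has no rotation angle $\pi$, and $d_0(k)=2^{k-1}k!$ otherwise. (ii) When $n>2k$, the conjugacy class $\mathcal O_{k,\Theta}(n)$ is the total space of a fibration with base $\mathcal G_{n-2k}(n)$ and fiber $\mathcal O_{k,\Theta}(2k)$.
   Context: $\mathbb E^n$ is Euclidean $n$-space. For $S\in SO(n)$, if the non-real complex conjugate pairs of eigenvalues (counting $-1$ as the pair $e^{\pm i\pi}$) are $\{e^{i\theta_j},e^{-i\theta_j}\}$, $0<\theta_j\le\pi$, $j=1,\dots,k$, then $\theta_1,\dots,\theta_k$ are the rotation angles of $S$ and $S$ is a $k$-rotation; equivalently $\mathbb E^n=\bigoplus_{j=1}^k V_j\oplus\Lambda$ orthogonally with $\dim V_j=2$, $S|_\Lambda=\mathrm{id}$, and $S|_{V_j}$ a non-identity rotation with eigenvalues $e^{\pm i\theta_j}$. It is regular if the rotation angles are pairwise distinct. $\mathfrak S(2;k)$ is the set of ordered orthogonal decompositions $\mathbb E^{2k}=V_1\oplus\dots\oplus V_k$ into 2-dimensional subspaces, topologized as the homogeneous space $O(2k)/O(2)^k$;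 the symmetric group $S_k$ acts freely by permuting summands, and $\mathcal D(2;k)=\mathfrak S(2;k)/S_k$. $\mathcal G_m(n)$ is the Grassmannian of $m$-dimensional linear subspaces of $\mathbb R^n$. *)

theory Defs
  imports "HOL-Analysis.Analysis"
begin

definition quotient_topology :: "'a topology \<Rightarrow> ('a \<Rightarrow> 'b) \<Rightarrow> 'b topology" where
  "quotient_topology X f =
     topology (\<lambda>U. U \<subseteq> f ` topspace X \<and> openin X {x \<in> topspace X. f x \<in> U})"

lemma istopology_quotient:
  "istopology (\<lambda>U. U \<subseteq> f ` topspace X \<and> openin X {x \<in> topspace X. f x \<in> U})"
proof -
  have i: "{x \<in> topspace X. f x \<in> S \<inter> T} =
      {x \<in> topspace X. f x \<in> S} \<inter> {x \<in> topspace X. f x \<in> T}" for S T by auto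
  have u: "{x \<in> topspace X. f x \<in> \<Union>K} = (\<Union>S\<in>K. {x \<in> topspace X. f x \<in> S})" for K
    by auto
  show ?thesis
    unfolding istopology_def i u by (auto intro!: openin_Int openin_Union)
qed

definition ortho_group :: "(real^'n^'n) set" where
  "ortho_group = {Q. orthogonal_matrix Q}"

text \<open>T acts as a k-rotation with rotation angles theta 0, ..., theta (k-1):
  V_j = span {u j, w j} are pairwise orthogonal 2-planes (orthonormal vectors u, w),
  T restricted to V_j is the rotation by theta j (eigenvalues exp(+-i theta j)),
  0 < theta j <= pi, and T is the identity on the orthogonal complement Lambda.\<close>
definition rotation_data ::
  "real^'n^'n \<Rightarrow> nat \<Rightarrow> (nat \<Rightarrow> real) \<Rightarrow> (nat \<Rightarrow> real^'n) \<Rightarrow> (nat \<Rightarrow> real^'n) \<Rightarrow> bool" where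
  "rotation_data T k \<theta> u w \<longleftrightarrow>
     (\<forall>i<k. \<forall>j<k. u i \<bullet> u j = (if i = j then 1 else 0) \<and>
                   w i \<bullet> w j = (if i = j then 1 else 0) \<and> u i \<bullet> w j = 0) \<and>
     (\<forall>j<k. 0 < \<theta> j \<and> \<theta> j \<le> pi \<and>
            T *v u j = cos (\<theta> j) *\<^sub>R u j + sin (\<theta> j) *\<^sub>R w j \<and>
            T *v w j = (- sin (\<theta> j)) *\<^sub>R u j + cos (\<theta> j) *\<^sub>R w j) \<and>
     (\<forall>x. (\<forall>j<k. x \<bullet> u j = 0 \<and> x \<bullet> w j = 0) \<longrightarrow> T *v x = x)"

definition k_rotation_with_angles :: "real^'n^'n \<Rightarrow> nat \<Rightarrow> (nat \<Rightarrow> real) \<Rightarrow> bool" where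
  "k_rotation_with_angles T k \<theta> \<longleftrightarrow> (\<exists>u w. rotation_data T k \<theta> u w)"

definition conj_class :: "real^'n^'n \<Rightarrow> (real^'n^'n) set" where
  "conj_class T = {Q ** T ** transpose Q | Q. orthogonal_matrix Q}"

text \<open>Ordered orthogonal decompositions V 0 + ... + V (k-1) of the whole space into
  2-dimensional subspaces (indices >= k carry the empty set, for canonicity).\<close>
definition ord_decomps :: "nat \<Rightarrow> (nat \<Rightarrow> (real^'n) set) set" where
  "ord_decomps k = {V. (\<forall>j<k. subspace (V j) \<and> dim (V j) = 2) \<and>
       (\<forall>i<k. \<forall>j<k. i \<noteq> j \<longrightarrow> (\<forall>x\<in>V i. \<forall>y\<in>V j. x \<bullet> y = 0)) \<and>
       span (\<Union>j<k. V j) = UNIV \<and> (\<forall>j\<ge>k. V j = {})}"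

definition act_decomp :: "real^'n^'n \<Rightarrow> (nat \<Rightarrow> (real^'n) set) \<Rightarrow> nat \<Rightarrow> (real^'n) set" where
  "act_decomp g V = (\<lambda>j. (\<lambda>x. g *v x) ` V j)"

text \<open>frak S(2;k) topologised as the homogeneous space O(2k)/O(2)^k.\<close>
definition sfrak_top :: "nat \<Rightarrow> (nat \<Rightarrow> (real^'n) set) topology" where
  "sfrak_top k = quotient_topology (top_of_set (ortho_group :: (real^'n^'n) set))
                   (\<lambda>g. act_decomp g (SOME V. V \<in> ord_decomps k))"

text \<open>D(2;k) = frak S(2;k) / S_k: an unordered decomposition is the set of its summands.\<close>
definition dfrak_top :: "nat \<Rightarrow> (real^'n) set set topology" where
  "dfrak_top k = quotient_topology (sfrak_top k) (\<lambda>V. V ` {..<k})"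

definition grass :: "nat \<Rightarrow> (real^'n) set set" where
  "grass m = {S. subspace S \<and> dim S = m}"

text \<open>Grassmannian G_m(n), topologised as the homogeneous space O(n)/(O(m) x O(n-m)).\<close>
definition grass_top :: "nat \<Rightarrow> (real^'n) set topology" where
  "grass_top m = quotient_topology (top_of_set (ortho_group :: (real^'n^'n) set))
                   (\<lambda>g. (\<lambda>x. g *v x) ` (SOME S. S \<in> grass m))"

definition covering_map_top :: "'a topology \<Rightarrow> 'b topology \<Rightarrow> ('a \<Rightarrow> 'b) \<Rightarrow> bool" where
  "covering_map_top E B p \<longleftrightarrow>
     continuous_map E B p \<and> p ` topspace E = topspace B \<and>
     (\<forall>b\<in>topspace B. \<exists>U. b \<in> U \<and> openin B U \<and>
        (\<exists>\<V>. \<Union>\<V> = {x \<in> topspace E. p x \<in> U} \<and> (\<forall>V\<in>\<V>. openin E V) \<and>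
             pairwise disjnt \<V> \<and>
             (\<forall>V\<in>\<V>. homeomorphic_map (subtopology E V) (subtopology B U) p)))"

definition sheeted_covering :: "nat \<Rightarrow> 'a topology \<Rightarrow> 'b topology \<Rightarrow> ('a \<Rightarrow> 'b) \<Rightarrow> bool" where
  "sheeted_covering d E B p \<longleftrightarrow> covering_map_top E B p \<and>
     (\<forall>b\<in>topspace B. finite {x \<in> topspace E. p x = b} \<and> card {x \<in> topspace E. p x = b} = d)"

definition fibre_bundle :: "'e topology \<Rightarrow> 'b topology \<Rightarrow> 'f topology \<Rightarrow> ('e \<Rightarrow> 'b) \<Rightarrow> bool" where
  "fibre_bundle E B F p \<longleftrightarrow>
     continuous_map E B p \<and> p ` topspace E = topspace B \<and>
     (\<forall>b\<in>topspace B. \<exists>U \<phi>. b \<in> U \<and> openin B U \<and>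
        homeomorphic_map (subtopology E {x \<in> topspace E. p x \<in> U})
                         (prod_topology (subtopology B U) F) \<phi> \<and>
        (\<forall>x\<in>topspace E. p x \<in> U \<longrightarrow> fst (\<phi> x) = p x))"

definition d0 :: "nat \<Rightarrow> (nat \<Rightarrow> real) \<Rightarrow> nat" where
  "d0 k \<theta> = (if \<exists>j<k. \<theta> j = pi then 2^(k-1) * fact k else 2^k * fact k)"

end

theory Submission
  imports Defs "HOL-Combinatorics.Permutations"
begin

text \<open>The base topologies are built from a base point picked by \<open>SOME\<close>, and the
  planes or the fixed space of \<open>T\<close> need not match it. Each half therefore replaces
  \<open>T\<close> by a conjugate \<open>T0\<close> whose planes, or whose fixed space, are exactly
  the chosen ones. The class does not change, and the conjugate of \<open>T0\<close> by
  \<open>g\<close> now lies over the point of the base that \<open>g\<close> represents. Openness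
  needs more than this compatibility: left multiplication must descend to the base, so that the
  fibres of its presentation are cosets of one stabiliser and preimages of images are unions of
  translates. Symmetrising forgets the orientation of each plane but not its angle, because cos is
  injective on the interval from 0 to pi; the eigenvalue 2 of the fixed vectors stays apart because
  every angle is positive. The lost orientation is one factor 2 per plane. Rotation by pi is minus
  the identity in either orientation, and regularity lets this happen in one plane only, whence the
  exponent \<open>k-1\<close>. The dimension of a space is fixed by its type, so the fibre in (ii)
  consists of matrices over another index type, and rectangular isometries \<open>F\<close> link the
  two.\<close>

text \<open>
  The conjugacy class of \<open>T\<close> consists of all rotations with the same angles, and
  \<open>g \<mapsto> g T g\<^sup>t\<close> presents it as a quotient of the compact group \<open>O(n)\<close>, as are the two base spaces.

  (i) Regularity makes the plane \<open>V\<^sub>j\<close> the eigenspace of the symmetric matrix \<open>S + S\<^sup>t\<close>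
  for the eigenvalue \<open>2 cos \<theta>\<^sub>j\<close>, so the map sending \<open>S\<close> to its set of planes is well
  defined; it is continuous, open and surjective because it is covered by the identity of \<open>O(n)\<close>.
  A point of its fibre is given by a permutation (which plane carries which angle) and an
  orientation of every plane whose angle is not \<open>\<pi>\<close>. An open continuous surjection
  from a Hausdorff space all of whose fibres have the same finite cardinality is a covering.

  (ii) The projection sends \<open>S\<close> to its fixed space. Locally on the Grassmannian, Gram-Schmidt gives an
  \<open>n \<times> 2k\<close> matrix \<open>F\<close>, depending continuously on the fixed space, whose orthonormal columns span
  the orthogonal complement of that space;
  then \<open>S \<mapsto> F\<^sup>t S F\<close> and \<open>R \<mapsto> 1 - F F\<^sup>t + F R F\<^sup>t\<close> are the mutually inverse fibre coordinates.
\<close>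

section \<open>Orthonormal families\<close>

text \<open>Families rather than sets: the labels allow two frames to be matched vector by vector
  and the planes of a rotation to be numbered.\<close>

definition orthonormal_on :: "'i set \<Rightarrow> ('i \<Rightarrow> 'a::real_inner) \<Rightarrow> bool" where
  "orthonormal_on I e \<longleftrightarrow> (\<forall>i\<in>I. \<forall>j\<in>I. e i \<bullet> e j = (if i = j then 1 else 0))"

lemma orthonormal_on_inner: "orthonormal_on I e \<Longrightarrow> i \<in> I \<Longrightarrow> j \<in> I \<Longrightarrow> e i \<bullet> e j = (if i = j then 1 else 0)"
  by (auto simp: orthonormal_on_def)

lemma orthonormal_on_sum_inner:
  assumes "orthonormal_on I e" "finite I" "i \<in> I"
  shows "(\<Sum>j\<in>I. c j *\<^sub>R e j) \<bullet> e i = c i"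
proof -
  have "(\<Sum>j\<in>I. c j *\<^sub>R e j) \<bullet> e i = (\<Sum>j\<in>I. if j = i then c j else 0)"
    unfolding inner_sum_left by (rule sum.cong) (use assms in \<open>auto simp: orthonormal_on_inner[OF assms(1)]\<close>)
  then show ?thesis using assms by simp
qed

lemma orthonormal_on_sums_inner:
  assumes "orthonormal_on I e" "finite I"
  shows "(\<Sum>j\<in>I. c j *\<^sub>R e j) \<bullet> (\<Sum>j\<in>I. d j *\<^sub>R e j) = (\<Sum>j\<in>I. c j * d j)"
  unfolding inner_sum_right[of _ "\<lambda>j. d j *\<^sub>R e j"]
  by (rule sum.cong) (use assms in \<open>auto simp: orthonormal_on_sum_inner[OF assms]\<close>)

lemma orthonormal_on_inj: "orthonormal_on I e \<Longrightarrow> inj_on e I"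
  by (rule inj_onI) (metis orthonormal_on_inner zero_neq_one)

lemma orthonormal_on_dim_span:
  fixes e :: "'i \<Rightarrow> 'a::euclidean_space"
  assumes "orthonormal_on I e"
  shows "dim (span (e ` I)) = card I"
proof -
  have "pairwise orthogonal (e ` I)"
    by (auto simp: pairwise_def orthogonal_def orthonormal_on_inner[OF assms])
  moreover have "0 \<notin> e ` I"
    using assms by (metis imageE inner_zero_left orthonormal_on_inner zero_neq_one)
  ultimately have "independent (e ` I)"
    by (rule pairwise_orthogonal_independent)
  then show ?thesis
    using card_image[OF orthonormal_on_inj[OF assms]] by (simp add: dim_eq_card_independent)
qed

lemma orthonormal_on_residual_inner:
  assumes "orthonormal_on I e" "finite I" "i \<in> I"
  shows "(x - (\<Sum>j\<in>I. (x \<bullet> e j) *\<^sub>R e j)) \<bullet> e i = 0"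
  by (simp add: inner_diff_left orthonormal_on_sum_inner[OF assms])

lemma span_orthogonal:
  assumes "\<And>v. v \<in> A \<Longrightarrow> x \<bullet> v = 0" "y \<in> span A"
  shows "x \<bullet> y = 0"
  using assms(2) by (induction rule: span_induct) (auto simp: subspace_def inner_add_right assms(1))

text \<open>The residual of the expansion lies in the span and is orthogonal to it, hence to
  itself.\<close>

lemma orthonormal_on_span_expand:
  assumes "orthonormal_on I e" "finite I" "x \<in> span (e ` I)"
  shows "(\<Sum>j\<in>I. (x \<bullet> e j) *\<^sub>R e j) = x"
proof -
  let ?y = "x - (\<Sum>j\<in>I. (x \<bullet> e j) *\<^sub>R e j)"
  have "?y \<in> span (e ` I)"
    by (rule span_diff[OF assms(3)]) (auto intro: span_sum span_scale span_base)
  moreover have "?y \<bullet> v = 0" if "v \<in> e ` I" for v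
    using that orthonormal_on_residual_inner[OF assms(1,2)] by auto
  ultimately have "?y \<bullet> ?y = 0"
    using span_orthogonal[of "e ` I" ?y ?y] by blast
  then show ?thesis
    unfolding inner_eq_zero_iff right_minus_eq by (rule sym)
qed

lemma orthogonal_complement_subspace: "subspace {x. \<forall>i\<in>I. x \<bullet> e i = 0}"
  by (auto simp: subspace_def inner_add_left)

lemma orthonormal_on_dim_complement:
  fixes e :: "'i \<Rightarrow> 'a::euclidean_space"
  assumes "orthonormal_on I e"
  shows "dim {x. \<forall>i\<in>I. x \<bullet> e i = 0} + card I = DIM('a)"
proof -
  have "{y \<in> UNIV. \<forall>x\<in>span (e ` I). orthogonal x y} = {x. \<forall>i\<in>I. x \<bullet> e i = 0}"
  proof (intro equalityI subsetI; clarsimp)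
    show "y \<bullet> e i = 0" if "\<forall>x\<in>span (e ` I). orthogonal x y" "i \<in> I" for y i
      using that by (metis imageI inner_commute orthogonal_def span_base)
    show "orthogonal x y" if "\<forall>i\<in>I. y \<bullet> e i = 0" "x \<in> span (e ` I)" for x y
      using span_orthogonal[of "e ` I" y x] that by (auto simp: orthogonal_def inner_commute[of x])
  qed
  then show ?thesis
    using dim_subspace_orthogonal_to_vectors[OF subspace_span subspace_UNIV subset_UNIV, of "e ` I"]
      orthonormal_on_dim_span[OF assms] by (simp only: dim_UNIV)
qed

lemma orthonormal_on_full:
  fixes e :: "'i \<Rightarrow> 'a::euclidean_space"
  assumes "orthonormal_on I e" "card I = DIM('a)" "\<And>i. i \<in> I \<Longrightarrow> x \<bullet> e i = 0"
  shows "x = 0"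
proof -
  have "dim {x. \<forall>i\<in>I. x \<bullet> e i = 0} = 0"
    using orthonormal_on_dim_complement[OF assms(1)] assms(2) by simp
  moreover have "x \<in> {x. \<forall>i\<in>I. x \<bullet> e i = 0}"
    using assms(3) by simp
  ultimately show ?thesis
    unfolding dim_eq_0 by blast
qed

lemma matrix_apply:
  fixes f :: "real^'n \<Rightarrow> real^'m"
  assumes "linear f"
  shows "matrix f *v x = f x"
  by (rule fun_cong[OF matrix_vector_mul(2)[OF assms]])

text \<open>Orthogonal matrices act transitively on orthonormal families of a given index set. The
  two orthogonal complements have equal dimension, so some isometry \<open>h\<close> joins them, and
  it is glued to the map sending \<open>e i\<close> to \<open>e' i\<close>; Pythagoras shows that
  the glued map preserves norms.\<close>

lemma orthonormal_on_extend:
  fixes e e' :: "'i \<Rightarrow> real^'n"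
  assumes e: "orthonormal_on I e" and e': "orthonormal_on I e'" and fin: "finite I"
  obtains Q where "orthogonal_matrix Q" "\<And>i. i \<in> I \<Longrightarrow> Q *v e i = e' i"
proof -
  let ?W = "{x. \<forall>i\<in>I. x \<bullet> e i = 0}" and ?W' = "{x. \<forall>i\<in>I. x \<bullet> e' i = 0}"
  have dims: "dim ?W = dim ?W'"
    using orthonormal_on_dim_complement[OF e] orthonormal_on_dim_complement[OF e'] by simp
  obtain h where h: "linear h" "h ` ?W = ?W'" "\<And>x. x \<in> ?W \<Longrightarrow> norm (h x) = norm x"
    using isometry_subspaces[OF orthogonal_complement_subspace orthogonal_complement_subspace dims] by blast
  define P where "P x = (\<Sum>j\<in>I. (x \<bullet> e j) *\<^sub>R e j)" for x
  define f where "f x = (\<Sum>j\<in>I. (x \<bullet> e j) *\<^sub>R e' j)" for x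
  have res: "x - P x \<in> ?W" for x
    using orthonormal_on_residual_inner[OF e fin] by (auto simp: P_def)
  have linP: "linear P" and linf: "linear f"
    unfolding P_def f_def
    by (rule linear_compose_sum, rule ballI, rule linearI, simp_all add: inner_add_left scaleR_add_left)+
  \<comment> \<open>\<open>f\<close> moves the component \<open>P x\<close> in the span of
    \<open>e\<close>, while \<open>h\<close> moves the remainder in the complement.\<close>
  define q where "q x = f x + h (x - P x)" for x
  have linq: "linear q"
    unfolding q_def
    using linear_compose_add[OF linf linear_compose[OF linear_compose_sub[OF linear_ident linP] h(1)]]
    unfolding o_def .
  have "norm (q x) = norm x" for x
  proof -
    have "orthogonal (f x) (h (x - P x))"
    proof -
      have "h (x - P x) \<in> ?W'" using h(2) res by blast
      then show ?thesis unfolding orthogonal_def f_def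
        by (simp add: inner_sum_left inner_commute[of "e' _"])
    qed
    moreover have "orthogonal (P x) (x - P x)"
    proof -
      have "P x \<in> span (e ` I)"
        unfolding P_def by (intro span_sum span_scale span_base imageI)
      then show ?thesis
        using span_orthogonal[of "e ` I" "x - P x"] res[of x]
        by (auto simp: orthogonal_def inner_commute)
    qed
    moreover have "norm (f x) = norm (P x)"
      unfolding norm_eq_sqrt_inner f_def P_def by (simp add: orthonormal_on_sums_inner[OF e fin] orthonormal_on_sums_inner[OF e' fin])
    ultimately have "(norm (q x))\<^sup>2 = (norm (P x + (x - P x)))\<^sup>2"
      using h(3)[OF res] unfolding q_def by (metis norm_add_Pythagorean)
    then show ?thesis by simp
  qed
  then have "orthogonal_transformation q"
    using linq orthogonal_transformation[of q] by blast
  then have "orthogonal_matrix (matrix q)"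
    by (simp add: orthogonal_transformation_matrix)
  moreover have "matrix q *v e i = e' i" if "i \<in> I" for i
  proof -
    have "P (e i) = e i" unfolding P_def using that by (intro orthonormal_on_span_expand[OF e fin] span_base imageI)
    moreover have "f (e i) = (\<Sum>j\<in>I. if j = i then e' j else 0)"
      unfolding f_def by (rule sum.cong) (use that in \<open>auto simp: orthonormal_on_inner[OF e]\<close>)
    ultimately show ?thesis
      using that fin linear_0[OF h(1)] by (simp add: matrix_apply[OF linq] q_def)
  qed
  ultimately show ?thesis using that by blast
qed

section \<open>Rotations in an orthonormal frame and their closed form\<close>

declare transpose_matrix_vector [simp del]

text \<open>Adjointness arguments all use this form, with the transpose kept as an explicit matrix;
  the simp rule turning \<open>transpose A *v x\<close> into \<open>x v* A\<close> is removed for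
  that reason.\<close>

lemma inner_transpose:
  fixes A :: "real^'n^'m"
  shows "(A *v x) \<bullet> y = x \<bullet> (transpose A *v y)"
  by (metis dot_lmul_matrix transpose_transpose vector_transpose_matrix)

lemma orthogonal_matrix_inner:
  fixes g :: "real^'n^'n"
  assumes "orthogonal_matrix g"
  shows "(g *v x) \<bullet> (g *v y) = x \<bullet> y"
  using assms by (simp add: inner_transpose matrix_vector_mul_assoc orthogonal_matrix)

lemma rotation_data_orthonormal:
  assumes "rotation_data T k \<theta> u w" "i < k" "j < k"
  shows "u i \<bullet> u j = (if i = j then 1 else 0)" "w i \<bullet> w j = (if i = j then 1 else 0)"
    "u i \<bullet> w j = 0" "w i \<bullet> u j = 0"
  using assms unfolding rotation_data_def by (auto simp: inner_commute)

text \<open>Merges the two lists of vectors into one family indexed by pairs, with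
  \<open>False\<close> marking \<open>u\<close> and \<open>True\<close> marking \<open>w\<close>, so
  that the facts on orthonormal families apply to both lists at once.\<close>

definition frame :: "(nat \<Rightarrow> 'a) \<Rightarrow> (nat \<Rightarrow> 'a) \<Rightarrow> nat \<times> bool \<Rightarrow> 'a" where
  "frame u w = (\<lambda>(j, b). if b then w j else u j)"

lemma frame_simps [simp]: "frame u w (j, True) = w j" "frame u w (j, False) = u j"
  by (auto simp: frame_def)

lemma sum_frame: "(\<Sum>p\<in>{..<k::nat} \<times> UNIV. g p) = (\<Sum>j<k. g (j, False) + g (j, True))"
  for g :: "_ \<Rightarrow> 'a::comm_monoid_add"
proof -
  have "(\<Sum>p\<in>{..<k} \<times> UNIV. g p) = (\<Sum>j<k. \<Sum>b\<in>UNIV. g (j, b))"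
    by (simp add: sum.cartesian_product)
  then show ?thesis by (simp add: UNIV_bool)
qed

lemma rotation_data_orthonormal_on: "rotation_data T k \<theta> u w \<Longrightarrow> orthonormal_on ({..<k} \<times> UNIV) (frame u w)"
  by (auto simp: orthonormal_on_def frame_def rotation_data_orthonormal)

lemma frame_residual_inner:
  assumes "orthonormal_on ({..<k} \<times> UNIV) (frame u w)" "i < k"
  shows "(x - (\<Sum>j<k. (x \<bullet> u j) *\<^sub>R u j + (x \<bullet> w j) *\<^sub>R w j)) \<bullet> u i = 0"
    "(x - (\<Sum>j<k. (x \<bullet> u j) *\<^sub>R u j + (x \<bullet> w j) *\<^sub>R w j)) \<bullet> w i = 0"
  using orthonormal_on_residual_inner[OF assms(1), of "(i, False)" x] orthonormal_on_residual_inner[OF assms(1), of "(i, True)" x] assms(2)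
  by (simp_all add: sum_frame)

text \<open>In each plane the rotation differs from the identity by (cos - 1) times the orthogonal
  projection plus sin times the quarter turn. The projection depends only on the plane, and the
  quarter turn also on its orientation; the count of rotations with given planes rests on this
  separation.\<close>

definition rot :: "nat \<Rightarrow> (nat \<Rightarrow> real) \<Rightarrow> (nat \<Rightarrow> 'a) \<Rightarrow> (nat \<Rightarrow> 'a) \<Rightarrow> 'a \<Rightarrow> 'a::real_inner" where
  "rot k \<theta> u w x = x + (\<Sum>j<k. (cos (\<theta> j) - 1) *\<^sub>R ((x \<bullet> u j) *\<^sub>R u j + (x \<bullet> w j) *\<^sub>R w j)
      + sin (\<theta> j) *\<^sub>R ((x \<bullet> u j) *\<^sub>R w j - (x \<bullet> w j) *\<^sub>R u j))"

text \<open>Rotation data determine the matrix: a vector is the sum of its components in the planes,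
  where \<open>T\<close> is prescribed, and a residual orthogonal to all planes, which
  \<open>T\<close> fixes.\<close>

lemma rotation_data_apply:
  assumes d: "rotation_data T k \<theta> u w"
  shows "T *v x = rot k \<theta> u w x"
proof -
  let ?s = "\<Sum>j<k. (x \<bullet> u j) *\<^sub>R u j + (x \<bullet> w j) *\<^sub>R w j"
  have "T *v (x - ?s) = x - ?s"
    using d frame_residual_inner[OF rotation_data_orthonormal_on[OF d], of _ x] unfolding rotation_data_def by blast
  then have "T *v x = x - ?s + T *v ?s"
    by (simp add: matrix_vector_mult_diff_distrib algebra_simps)
  also have "T *v ?s = (\<Sum>j<k. (x \<bullet> u j) *\<^sub>R (T *v u j) + (x \<bullet> w j) *\<^sub>R (T *v w j))"
    by (simp add: linear_sum[OF matrix_vector_mul_linear] matrix_vector_right_distrib scalar_mult_eq_scaleR[symmetric] vec.scale)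
  also have "\<dots> = (\<Sum>j<k. (x \<bullet> u j) *\<^sub>R (cos (\<theta> j) *\<^sub>R u j + sin (\<theta> j) *\<^sub>R w j)
      + (x \<bullet> w j) *\<^sub>R ((- sin (\<theta> j)) *\<^sub>R u j + cos (\<theta> j) *\<^sub>R w j))"
    by (rule sum.cong) (use d in \<open>auto simp: rotation_data_def\<close>)
  finally have "T *v x = x + ((\<Sum>j<k. (x \<bullet> u j) *\<^sub>R (cos (\<theta> j) *\<^sub>R u j + sin (\<theta> j) *\<^sub>R w j)
      + (x \<bullet> w j) *\<^sub>R ((- sin (\<theta> j)) *\<^sub>R u j + cos (\<theta> j) *\<^sub>R w j)) - ?s)"
    by simp
  then show ?thesis
    unfolding rot_def sum_subtractf[symmetric] by (simp add: algebra_simps)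
qed

lemma rot_linear: "linear (rot k \<theta> u w)"
  unfolding rot_def
  by (intro linear_compose_add linear_ident linear_compose_sum ballI linear_compose_sub linear_compose_scale_right)
     (auto intro!: linearI simp: algebra_simps)

lemma rot_on_frame:
  assumes o: "orthonormal_on ({..<k} \<times> UNIV) (frame u w)" and i: "i < k"
  shows "rot k \<theta> u w (u i) = cos (\<theta> i) *\<^sub>R u i + sin (\<theta> i) *\<^sub>R w i"
    "rot k \<theta> u w (w i) = (- sin (\<theta> i)) *\<^sub>R u i + cos (\<theta> i) *\<^sub>R w i"
proof -
  have uu: "u i \<bullet> u j = (if j = i then 1 else 0)" "w i \<bullet> w j = (if j = i then 1 else 0)"
    "u i \<bullet> w j = 0" "w i \<bullet> u j = 0" if "j < k" for j
    using orthonormal_on_inner[OF o, of "(i,False)" "(j,False)"] orthonormal_on_inner[OF o, of "(i,True)" "(j,True)"]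
      orthonormal_on_inner[OF o, of "(i,False)" "(j,True)"] orthonormal_on_inner[OF o, of "(i,True)" "(j,False)"] that i by auto
  have "rot k \<theta> u w (u i) = u i + (\<Sum>j<k. if j = i then (cos (\<theta> i) - 1) *\<^sub>R u i + sin (\<theta> i) *\<^sub>R w i else 0)"
    unfolding rot_def by (intro arg_cong2[where f="(+)"] refl sum.cong) (auto simp: uu)
  then show "rot k \<theta> u w (u i) = cos (\<theta> i) *\<^sub>R u i + sin (\<theta> i) *\<^sub>R w i"
    using i by (simp add: algebra_simps)
  have "rot k \<theta> u w (w i) = w i + (\<Sum>j<k. if j = i then (cos (\<theta> i) - 1) *\<^sub>R w i - sin (\<theta> i) *\<^sub>R u i else 0)"
    unfolding rot_def by (intro arg_cong2[where f="(+)"] refl sum.cong) (auto simp: uu)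
  then show "rot k \<theta> u w (w i) = (- sin (\<theta> i)) *\<^sub>R u i + cos (\<theta> i) *\<^sub>R w i"
    using i by (simp add: algebra_simps)
qed

lemma rotation_data_rot:
  assumes o: "orthonormal_on ({..<k} \<times> UNIV) (frame u w)" and "\<And>j. j < k \<Longrightarrow> 0 < \<theta> j \<and> \<theta> j \<le> pi"
  shows "rotation_data (matrix (rot k \<theta> u w)) k \<theta> u w"
proof -
  have ww: "u i \<bullet> u j = (if i = j then 1 else 0)" "w i \<bullet> w j = (if i = j then 1 else 0)"
    "u i \<bullet> w j = 0" if "i < k" "j < k" for i j
    using orthonormal_on_inner[OF o, of "(i,False)" "(j,False)"] orthonormal_on_inner[OF o, of "(i,True)" "(j,True)"]
      orthonormal_on_inner[OF o, of "(i,False)" "(j,True)"] that by auto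
  have "rot k \<theta> u w x = x" if "\<forall>j<k. x \<bullet> u j = 0 \<and> x \<bullet> w j = 0" for x
    using that unfolding rot_def by simp
  moreover have "matrix (rot k \<theta> u w) *v x = rot k \<theta> u w x" for x
    by (rule matrix_apply) (rule rot_linear)
  ultimately show ?thesis
    using assms(2) unfolding rotation_data_def
    by (simp add: ww rot_on_frame[OF o])
qed

section \<open>Conjugacy classes and eigenplanes\<close>

lemma frame_inner:
  assumes "orthonormal_on ({..<k} \<times> UNIV) (frame u w)" "i < k" "j < k"
  shows "u i \<bullet> u j = (if i = j then 1 else 0)" "w i \<bullet> w j = (if i = j then 1 else 0)"
    "u i \<bullet> w j = 0" "w i \<bullet> u j = 0"
  using orthonormal_on_inner[OF assms(1), of "(i,False)" "(j,False)"] orthonormal_on_inner[OF assms(1), of "(i,True)" "(j,True)"]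
    orthonormal_on_inner[OF assms(1), of "(i,False)" "(j,True)"] orthonormal_on_inner[OF assms(1), of "(i,True)" "(j,False)"]
    assms(2,3) by auto

lemma orthonormal_on_frameI:
  assumes "\<And>i j. i < k \<Longrightarrow> j < k \<Longrightarrow> u i \<bullet> u j = (if i = j then 1 else 0)"
    "\<And>i j. i < k \<Longrightarrow> j < k \<Longrightarrow> w i \<bullet> w j = (if i = j then 1 else 0)"
    "\<And>i j. i < k \<Longrightarrow> j < k \<Longrightarrow> u i \<bullet> w j = 0"
  shows "orthonormal_on ({..<k} \<times> UNIV) (frame u w)"
  using assms(1,2) assms(3) by (auto simp: orthonormal_on_def frame_def inner_commute[of "w _" "u _"])

lemma rot_inner_frame:
  assumes o: "orthonormal_on ({..<k} \<times> UNIV) (frame u w)" and i: "i < k"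
  shows "rot k \<theta> u w x \<bullet> u i = cos (\<theta> i) * (x \<bullet> u i) - sin (\<theta> i) * (x \<bullet> w i)"
    "rot k \<theta> u w x \<bullet> w i = sin (\<theta> i) * (x \<bullet> u i) + cos (\<theta> i) * (x \<bullet> w i)"
proof -
  note inn = frame_inner[OF o _ i]
  have "rot k \<theta> u w x \<bullet> u i = x \<bullet> u i + (\<Sum>j<k. if j = i then
      (cos (\<theta> i) - 1) * (x \<bullet> u i) - sin (\<theta> i) * (x \<bullet> w i) else 0)"
    unfolding rot_def inner_add_left inner_sum_left
    by (intro arg_cong2[where f="(+)"] refl sum.cong)
       (auto simp: inn inner_add_left inner_diff_left)
  then show "rot k \<theta> u w x \<bullet> u i = cos (\<theta> i) * (x \<bullet> u i) - sin (\<theta> i) * (x \<bullet> w i)"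
    using i by (simp add: algebra_simps)
  have "rot k \<theta> u w x \<bullet> w i = x \<bullet> w i + (\<Sum>j<k. if j = i then
      (cos (\<theta> i) - 1) * (x \<bullet> w i) + sin (\<theta> i) * (x \<bullet> u i) else 0)"
    unfolding rot_def inner_add_left inner_sum_left
    by (intro arg_cong2[where f="(+)"] refl sum.cong)
       (auto simp: inn inner_add_left inner_diff_left)
  then show "rot k \<theta> u w x \<bullet> w i = sin (\<theta> i) * (x \<bullet> u i) + cos (\<theta> i) * (x \<bullet> w i)"
    using i by (simp add: algebra_simps)
qed

lemma rot_cong:
  assumes "\<And>j. j < k \<Longrightarrow> u j = u' j" "\<And>j. j < k \<Longrightarrow> w j = w' j"
  shows "rot k \<theta> u w x = rot k \<theta> u' w' x"
  unfolding rot_def using assms by (intro arg_cong2[where f="(+)"] refl sum.cong) auto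

lemma eq_by_inner:
  fixes x y :: "'a::real_inner"
  assumes "\<And>z. z \<bullet> x = z \<bullet> y"
  shows "x = y"
  using assms[of "x - y"] inner_diff_right[of "x - y" x y] by simp

text \<open>The transpose turns each plane by the opposite angle. Its values are found by duality:
  the inner products with an arbitrary \<open>z\<close> reduce to coordinates of
  \<open>T *v z\<close>, which the closed form supplies.\<close>

lemma rotation_data_transpose:
  assumes d: "rotation_data T k \<theta> u w"
  shows "i < k \<Longrightarrow> transpose T *v u i = cos (\<theta> i) *\<^sub>R u i - sin (\<theta> i) *\<^sub>R w i"
    "i < k \<Longrightarrow> transpose T *v w i = sin (\<theta> i) *\<^sub>R u i + cos (\<theta> i) *\<^sub>R w i"
    "\<forall>j<k. x \<bullet> u j = 0 \<and> x \<bullet> w j = 0 \<Longrightarrow> transpose T *v x = x"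
proof -
  note o = rotation_data_orthonormal_on[OF d] and app = rotation_data_apply[OF d]
  show "transpose T *v u i = cos (\<theta> i) *\<^sub>R u i - sin (\<theta> i) *\<^sub>R w i" if "i < k"
    by (rule eq_by_inner)
       (simp add: inner_transpose[symmetric] app rot_inner_frame[OF o that] inner_diff_right)
  show "transpose T *v w i = sin (\<theta> i) *\<^sub>R u i + cos (\<theta> i) *\<^sub>R w i" if "i < k"
    by (rule eq_by_inner)
       (simp add: inner_transpose[symmetric] app rot_inner_frame[OF o that] inner_add_right)
  show "transpose T *v x = x" if x: "\<forall>j<k. x \<bullet> u j = 0 \<and> x \<bullet> w j = 0"
  proof (rule eq_by_inner)
    fix z
    have "u j \<bullet> x = 0" "w j \<bullet> x = 0" if "j < k" for j
      using x that by (simp_all add: inner_commute[of _ x])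
    then show "z \<bullet> (transpose T *v x) = z \<bullet> x"
      unfolding inner_transpose[symmetric] app rot_def
      by (simp add: inner_add_left inner_diff_left inner_sum_left)
  qed
qed

lemma rotation_data_conj:
  fixes Q :: "real^'n^'n"
  assumes d: "rotation_data T k \<theta> u w" and Q: "orthogonal_matrix Q"
  shows "rotation_data (Q ** T ** transpose Q) k \<theta> (\<lambda>j. Q *v u j) (\<lambda>j. Q *v w j)"
proof -
  have QQ: "transpose Q *v (Q *v x) = x" "Q *v (transpose Q *v x) = x" for x
    using Q by (simp_all add: matrix_vector_mul_assoc orthogonal_matrix_def)
  have ap: "(Q ** T ** transpose Q) *v x = Q *v (T *v (transpose Q *v x))" for x
    by (simp add: matrix_vector_mul_assoc matrix_mul_assoc)
  have fixed: "(Q ** T ** transpose Q) *v x = x" if "\<forall>j<k. x \<bullet> (Q *v u j) = 0 \<and> x \<bullet> (Q *v w j) = 0" for x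
  proof -
    have "\<forall>j<k. (transpose Q *v x) \<bullet> u j = 0 \<and> (transpose Q *v x) \<bullet> w j = 0"
      using that by (simp add: inner_transpose)
    then have "T *v (transpose Q *v x) = transpose Q *v x"
      using d unfolding rotation_data_def by blast
    then show ?thesis by (simp only: ap QQ)
  qed
  have frame: "Q *v (T *v u j) = cos (\<theta> j) *\<^sub>R (Q *v u j) + sin (\<theta> j) *\<^sub>R (Q *v w j)"
    "Q *v (T *v w j) = (- sin (\<theta> j)) *\<^sub>R (Q *v u j) + cos (\<theta> j) *\<^sub>R (Q *v w j)" if "j < k" for j
  proof -
    have "T *v u j = cos (\<theta> j) *\<^sub>R u j + sin (\<theta> j) *\<^sub>R w j"
      "T *v w j = (- sin (\<theta> j)) *\<^sub>R u j + cos (\<theta> j) *\<^sub>R w j"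
      using d that unfolding rotation_data_def by blast+
    then show "Q *v (T *v u j) = cos (\<theta> j) *\<^sub>R (Q *v u j) + sin (\<theta> j) *\<^sub>R (Q *v w j)"
      "Q *v (T *v w j) = (- sin (\<theta> j)) *\<^sub>R (Q *v u j) + cos (\<theta> j) *\<^sub>R (Q *v w j)"
      by (simp_all only: matrix_vector_right_distrib matrix_vector_mult_scaleR)
  qed
  show ?thesis
    unfolding rotation_data_def orthogonal_matrix_inner[OF Q] ap QQ
  proof (rule conjI[OF _ conjI])
    show "\<forall>j<k. 0 < \<theta> j \<and> \<theta> j \<le> pi \<and>
        Q *v (T *v u j) = cos (\<theta> j) *\<^sub>R (Q *v u j) + sin (\<theta> j) *\<^sub>R (Q *v w j) \<and>
        Q *v (T *v w j) = (- sin (\<theta> j)) *\<^sub>R (Q *v u j) + cos (\<theta> j) *\<^sub>R (Q *v w j)"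
      using frame d unfolding rotation_data_def by simp
  qed (rule d[unfolded rotation_data_def, THEN conjunct1], use fixed in \<open>simp add: ap\<close>)
qed

text \<open>A matrix \<open>Q\<close> carrying one frame to the other conjugates \<open>T\<close>
  into a rotation with the frame of \<open>S\<close> and the same angles, and such data leave only
  one matrix.\<close>

lemma rotation_data_conjugate:
  fixes T S :: "real^'n^'n"
  assumes d: "rotation_data T k \<theta> u w" and d': "rotation_data S k \<theta> u' w'"
  obtains Q where "orthogonal_matrix Q" "S = Q ** T ** transpose Q"
proof -
  obtain Q :: "real^'n^'n" where Q: "orthogonal_matrix Q"
    "\<And>p. p \<in> {..<k} \<times> UNIV \<Longrightarrow> Q *v frame u w p = frame u' w' p"
    using orthonormal_on_extend[OF rotation_data_orthonormal_on[OF d] rotation_data_orthonormal_on[OF d']] by auto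
  have "u' j = Q *v u j" "w' j = Q *v w j" if "j < k" for j
    using Q(2)[of "(j, False)"] Q(2)[of "(j, True)"] that by auto
  then have "S *v x = (Q ** T ** transpose Q) *v x" for x
    unfolding rotation_data_apply[OF d'] rotation_data_apply[OF rotation_data_conj[OF d Q(1)]]
    by (intro rot_cong) auto
  then have "S = Q ** T ** transpose Q"
    by (simp add: matrix_eq)
  then show ?thesis using Q(1) that by blast
qed

text \<open>Membership in the class becomes a condition on angles alone, so any other rotation with
  these angles may serve as its base point.\<close>

lemma conj_class_eq:
  fixes T :: "real^'n^'n"
  assumes "k_rotation_with_angles T k \<theta>"
  shows "conj_class T = {S. k_rotation_with_angles S k \<theta>}"
proof -
  obtain u w where d: "rotation_data T k \<theta> u w"
    using assms by (auto simp: k_rotation_with_angles_def)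
  show ?thesis
  proof (intro equalityI subsetI CollectI)
    fix S :: "real^'n^'n" assume "S \<in> conj_class T"
    then show "k_rotation_with_angles S k \<theta>"
      using rotation_data_conj[OF d] unfolding conj_class_def k_rotation_with_angles_def by blast
  next
    fix S :: "real^'n^'n" assume "S \<in> {S. k_rotation_with_angles S k \<theta>}"
    then obtain u' w' where "rotation_data S k \<theta> u' w'"
      by (auto simp: k_rotation_with_angles_def)
    from rotation_data_conjugate[OF d this] show "S \<in> conj_class T"
      unfolding conj_class_def by blast
  qed
qed

lemma rotation_data_fixed_iff:
  assumes d: "rotation_data T k \<theta> u w"
  shows "T *v x = x \<longleftrightarrow> (\<forall>j<k. x \<bullet> u j = 0 \<and> x \<bullet> w j = 0)"
proof
  assume fx: "T *v x = x"
  show "\<forall>j<k. x \<bullet> u j = 0 \<and> x \<bullet> w j = 0"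
  proof (intro allI impI)
    fix j assume j: "j < k"
    let ?a = "x \<bullet> u j" and ?b = "x \<bullet> w j" and ?c = "cos (\<theta> j)" and ?s = "sin (\<theta> j)"
    have e: "?c * ?a - ?s * ?b = ?a" "?s * ?a + ?c * ?b = ?b"
      using rot_inner_frame[OF rotation_data_orthonormal_on[OF d] j, of \<theta> x] fx
      by (simp_all add: rotation_data_apply[OF d, symmetric])
    have "?c < 1"
      using d j cos_monotone_0_pi[of 0 "\<theta> j"] unfolding rotation_data_def by auto
    \<comment> \<open>For a planar rotation \<open>R\<close> by the angle \<theta>, the squared
      length of \<open>R v - v\<close> is \<open>2 - 2 * cos \<theta>\<close> times that of
      \<open>v\<close>. The summand with \<open>1 - ?c\<^sup>2 - ?s\<^sup>2\<close> is zero; it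
      turns this into a polynomial identity in independent variables.\<close>
    have "(2 - 2 * ?c) * (?a\<^sup>2 + ?b\<^sup>2) = (?c * ?a - ?s * ?b - ?a)\<^sup>2 + (?s * ?a + ?c * ?b - ?b)\<^sup>2
        + (1 - ?c\<^sup>2 - ?s\<^sup>2) * (?a\<^sup>2 + ?b\<^sup>2)"
      by algebra
    also have "\<dots> = 0" using e sin_cos_squared_add2[of "\<theta> j"] by (simp add: algebra_simps)
    finally have "?a\<^sup>2 + ?b\<^sup>2 = 0" using \<open>?c < 1\<close> by simp
    then show "?a = 0 \<and> ?b = 0" by (simp add: sum_power2_eq_zero_iff)
  qed
next
  assume "\<forall>j<k. x \<bullet> u j = 0 \<and> x \<bullet> w j = 0"
  then show "T *v x = x" using d unfolding rotation_data_def by blast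
qed

definition eigenplane :: "real \<Rightarrow> real^'n^'n \<Rightarrow> (real^'n) set" where
  "eigenplane t S = {x. S *v x + transpose S *v x = (2 * cos t) *\<^sub>R x}"

definition eigenplanes :: "nat \<Rightarrow> (nat \<Rightarrow> real) \<Rightarrow> real^'n^'n \<Rightarrow> (real^'n) set set" where
  "eigenplanes k \<theta> S = (\<lambda>j. eigenplane (\<theta> j) S) ` {..<k}"

text \<open>Eigenvectors of a symmetric map for different eigenvalues are orthogonal. The other
  planes have eigenvalues \<open>2 * cos (\<theta> i)\<close>, different by regularity, and the
  fixed vectors have eigenvalue 2; a vector of the eigenplane is therefore orthogonal to all of them
  and lies in the plane numbered \<open>j\<close>.\<close>

lemma eigenplane_eq_span:
  assumes d: "rotation_data T k \<theta> u w" and inj: "inj_on \<theta> {..<k}" and j: "j < k"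
  shows "eigenplane (\<theta> j) T = span {u j, w j}"
proof -
  note o = rotation_data_orthonormal_on[OF d]
  have rng: "0 < \<theta> i" "\<theta> i \<le> pi" if "i < k" for i
    using d that unfolding rotation_data_def by auto
  have Nu: "T *v u i + transpose T *v u i = (2 * cos (\<theta> i)) *\<^sub>R u i"
    and Nw: "T *v w i + transpose T *v w i = (2 * cos (\<theta> i)) *\<^sub>R w i" if "i < k" for i
    using rotation_data_transpose(1,2)[OF d that] rot_on_frame[OF o that, of \<theta>]
    by (simp_all add: rotation_data_apply[OF d] vec_eq_iff)
  have sub: "subspace (eigenplane (\<theta> j) T)"
    unfolding eigenplane_def
    by (auto simp: subspace_def matrix_vector_right_distrib matrix_vector_mult_scaleR algebra_simps)
       (simp add: scaleR_right_distrib[symmetric])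
  have sym: "(T *v x + transpose T *v x) \<bullet> y = x \<bullet> (T *v y + transpose T *v y)" for x y
    by (simp add: inner_add_left inner_add_right inner_transpose)
  show ?thesis
  proof
    show "span {u j, w j} \<subseteq> eigenplane (\<theta> j) T"
      by (rule span_minimal[OF _ sub]) (use Nu[OF j] Nw[OF j] in \<open>auto simp: eigenplane_def\<close>)
    show "eigenplane (\<theta> j) T \<subseteq> span {u j, w j}"
    proof
      fix x assume "x \<in> eigenplane (\<theta> j) T"
      then have x: "T *v x + transpose T *v x = (2 * cos (\<theta> j)) *\<^sub>R x"
        by (simp add: eigenplane_def)
      have ev: "x \<bullet> v = 0" if "T *v v + transpose T *v v = c *\<^sub>R v" "c \<noteq> 2 * cos (\<theta> j)" for v c
        using sym[of x v] x that by simp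
      have cne: "2 * cos (\<theta> i) \<noteq> 2 * cos (\<theta> j)" if "i < k" "i \<noteq> j" for i
        using cos_inj_pi[of "\<theta> i" "\<theta> j"] rng[of i] rng[of j] that j inj by (auto simp: inj_on_def)
      have z: "x \<bullet> u i = 0" "x \<bullet> w i = 0" if "i < k" "i \<noteq> j" for i
        using ev[OF Nu cne] ev[OF Nw cne] that by auto
      define s where "s = (\<Sum>i<k. (x \<bullet> u i) *\<^sub>R u i + (x \<bullet> w i) *\<^sub>R w i)"
      have s: "s = (x \<bullet> u j) *\<^sub>R u j + (x \<bullet> w j) *\<^sub>R w j"
      proof -
        have "s = (\<Sum>i<k. if i = j then (x \<bullet> u j) *\<^sub>R u j + (x \<bullet> w j) *\<^sub>R w j else 0)"
          unfolding s_def by (rule sum.cong) (auto simp: z)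
        then show ?thesis using j by simp
      qed
      \<comment> \<open>The part of \<open>x\<close> orthogonal to every plane. It is an eigenvector
        for 2, hence orthogonal to \<open>x\<close>, and it is orthogonal to \<open>s\<close>; so it
        is orthogonal to itself.\<close>
      define y where "y = x - s"
      have y0: "\<forall>i<k. y \<bullet> u i = 0 \<and> y \<bullet> w i = 0"
        unfolding y_def s_def using frame_residual_inner[OF o] by blast
      have "T *v y + transpose T *v y = 2 *\<^sub>R y"
        using rotation_data_transpose(3)[OF d y0] rotation_data_fixed_iff[OF d, of y] y0
        by (simp add: scaleR_2)
      moreover have "cos (\<theta> j) < 1"
        using rng[OF j] cos_monotone_0_pi[of 0 "\<theta> j"] by auto
      ultimately have "x \<bullet> y = 0" using ev[of y 2] by auto
      moreover have "y \<bullet> s = 0"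
        unfolding s using y0 j by (simp add: inner_add_right)
      moreover have "y \<bullet> y = (x - s) \<bullet> y" by (simp only: y_def)
      ultimately have "y \<bullet> y = 0"
        by (simp only: inner_diff_left inner_commute[of s] diff_self)
      then have "x = s" by (simp add: y_def)
      moreover have "s \<in> span {u j, w j}"
        unfolding s by (intro span_add span_scale span_base) auto
      ultimately show "x \<in> span {u j, w j}" by (simp only:)
    qed
  qed
qed

lemma eigenplanes_eq:
  assumes "rotation_data T k \<theta> u w" "inj_on \<theta> {..<k}"
  shows "eigenplanes k \<theta> T = (\<lambda>j. span {u j, w j}) ` {..<k}"
  unfolding eigenplanes_def using eigenplane_eq_span[OF assms] by auto

text \<open>The orthogonal projection onto a plane ignores the choice of orthonormal basis, and the
  quarter turn is multiplied by the determinant \<epsilon> of the change of basis. These are the two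
  ingredients of \<open>rot\<close>.\<close>

lemma orthonormal_pair_same_span:
  fixes u w u' w' :: "'a::real_inner"
  assumes o: "u \<bullet> u = 1" "w \<bullet> w = 1" "u \<bullet> w = 0" and o': "u' \<bullet> u' = 1" "w' \<bullet> w' = 1" "u' \<bullet> w' = 0"
    and sp: "span {u', w'} = span {u, w}"
  obtains \<epsilon> :: real where "\<epsilon> = 1 \<or> \<epsilon> = -1"
    "\<And>x. (x \<bullet> u') *\<^sub>R u' + (x \<bullet> w') *\<^sub>R w' = (x \<bullet> u) *\<^sub>R u + (x \<bullet> w) *\<^sub>R w"
    "\<And>x. (x \<bullet> u') *\<^sub>R w' - (x \<bullet> w') *\<^sub>R u' = \<epsilon> *\<^sub>R ((x \<bullet> u) *\<^sub>R w - (x \<bullet> w) *\<^sub>R u)"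
proof -
  have "u' \<in> span {u, w}" "w' \<in> span {u, w}"
    using sp span_base[of u' "{u', w'}"] span_base[of w' "{u', w'}"] by auto
  then obtain a b c d where u': "u' = a *\<^sub>R u + b *\<^sub>R w" and w': "w' = c *\<^sub>R u + d *\<^sub>R w"
    unfolding span_insert span_empty by (auto simp: algebra_simps)
  have wu: "w \<bullet> u = 0" using o(3) by (simp add: inner_commute)
  have e: "a * a + b * b = 1" "c * c + d * d = 1" "a * c + b * d = 0"
    using o' o wu by (simp_all add: u' w' inner_add_left inner_add_right mult.commute)
  define \<epsilon> where "\<epsilon> = a * d - b * c"
  have "\<epsilon> * \<epsilon> = 1" using e unfolding \<epsilon>_def by algebra
  then have pm: "\<epsilon> = 1 \<or> \<epsilon> = -1" by (simp add: square_eq_1_iff)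
  \<comment> \<open>The second row of an orthogonal 2 by 2 matrix is the quarter turn of the first
    row, up to the sign given by the determinant.\<close>
  have c: "c = - \<epsilon> * b" and d: "d = \<epsilon> * a" using e unfolding \<epsilon>_def by algebra+
  have "(x \<bullet> u') *\<^sub>R u' + (x \<bullet> w') *\<^sub>R w' = (x \<bullet> u) *\<^sub>R u + (x \<bullet> w) *\<^sub>R w" for x
  proof -
    define p q where "p = x \<bullet> u" and "q = x \<bullet> w"
    have "(x \<bullet> u') *\<^sub>R u' + (x \<bullet> w') *\<^sub>R w' =
      ((a * p + b * q) * a + (c * p + d * q) * c) *\<^sub>R u + ((a * p + b * q) * b + (c * p + d * q) * d) *\<^sub>R w"
      by (simp add: u' w' inner_add_right p_def q_def algebra_simps)
    also have "(a * p + b * q) * a + (c * p + d * q) * c = p"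
      using e \<open>\<epsilon> * \<epsilon> = 1\<close> unfolding c d by algebra
    also have "(a * p + b * q) * b + (c * p + d * q) * d = q"
      using e \<open>\<epsilon> * \<epsilon> = 1\<close> unfolding c d by algebra
    finally show ?thesis by (simp add: p_def q_def)
  qed
  moreover have "(x \<bullet> u') *\<^sub>R w' - (x \<bullet> w') *\<^sub>R u' = \<epsilon> *\<^sub>R ((x \<bullet> u) *\<^sub>R w - (x \<bullet> w) *\<^sub>R u)" for x
  proof -
    define p q where "p = x \<bullet> u" and "q = x \<bullet> w"
    have "(x \<bullet> u') *\<^sub>R w' - (x \<bullet> w') *\<^sub>R u' =
      ((a * p + b * q) * c - (c * p + d * q) * a) *\<^sub>R u + ((a * p + b * q) * d - (c * p + d * q) * b) *\<^sub>R w"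
      by (simp add: u' w' inner_add_right p_def q_def algebra_simps)
    also have "(a * p + b * q) * c - (c * p + d * q) * a = - \<epsilon> * q"
      unfolding \<epsilon>_def by algebra
    also have "(a * p + b * q) * d - (c * p + d * q) * b = \<epsilon> * p"
      unfolding \<epsilon>_def by algebra
    finally show ?thesis by (simp add: p_def q_def algebra_simps)
  qed
  ultimately show ?thesis using pm that by blast
qed

section \<open>Counting the rotations with given eigenplanes\<close>

lemma span_frame_inj:
  assumes o: "orthonormal_on ({..<k} \<times> UNIV) (frame u w)" and "i < k" "j < k" "span {u i, w i} = span {u j, w j}"
  shows "i = j"
proof (rule ccontr)
  assume ne: "i \<noteq> j"
  have "u i \<in> span {u j, w j}"
    using assms(4) span_base[of "u i" "{u i, w i}"] by simp
  moreover have "u i \<bullet> v = 0" if "v \<in> {u j, w j}" for v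
    using that ne frame_inner[OF o \<open>i < k\<close> \<open>j < k\<close>] by auto
  ultimately have "u i \<bullet> u i = 0"
    by (rule span_orthogonal[rotated])
  then show False
    using frame_inner(1)[OF o \<open>i < k\<close> \<open>i < k\<close>] by simp
qed

text \<open>The permutation tells which reference plane carries the angle numbered \<open>j\<close>;
  the set \<open>A\<close> collects the angles whose plane is turned with the reverse orientation,
  encoded by negating the second basis vector.\<close>

definition signed_rot :: "nat \<Rightarrow> (nat \<Rightarrow> real) \<Rightarrow> (nat \<Rightarrow> real^'n) \<Rightarrow> (nat \<Rightarrow> real^'n)
    \<Rightarrow> (nat \<Rightarrow> nat) \<times> nat set \<Rightarrow> real^'n^'n" where
  "signed_rot k \<theta> u w = (\<lambda>(\<sigma>, A). matrix (rot k \<theta> (\<lambda>j. u (\<sigma> j))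
      (\<lambda>j. (if j \<in> A then -1 else 1) *\<^sub>R w (\<sigma> j))))"

lemma signed_rot_data:
  assumes o: "orthonormal_on ({..<k} \<times> UNIV) (frame u w)" and rng: "\<And>j. j < k \<Longrightarrow> 0 < \<theta> j \<and> \<theta> j \<le> pi"
    and \<sigma>: "\<sigma> permutes {..<k}"
  shows "rotation_data (signed_rot k \<theta> u w (\<sigma>, A)) k \<theta> (\<lambda>j. u (\<sigma> j))
      (\<lambda>j. (if j \<in> A then -1 else 1) *\<^sub>R w (\<sigma> j))"
  unfolding signed_rot_def prod.case
proof (rule rotation_data_rot[OF orthonormal_on_frameI rng])
  fix i j assume "i < k" "j < k"
  then have lt: "\<sigma> i < k" "\<sigma> j < k"
    using permutes_in_image[OF \<sigma>] by auto
  have eq: "\<sigma> i = \<sigma> j \<longleftrightarrow> i = j"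
    using permutes_inj[OF \<sigma>] by (simp add: inj_eq)
  show "u (\<sigma> i) \<bullet> u (\<sigma> j) = (if i = j then 1 else 0)"
    "((if i \<in> A then -1 else 1) *\<^sub>R w (\<sigma> i)) \<bullet> ((if j \<in> A then -1 else 1) *\<^sub>R w (\<sigma> j)) = (if i = j then 1 else 0)"
    "u (\<sigma> i) \<bullet> ((if j \<in> A then -1 else 1) *\<^sub>R w (\<sigma> j)) = 0"
    using frame_inner[OF o lt] eq by auto
qed

lemma span_pair_sign: "span {u, (if b then -1 else 1) *\<^sub>R w} = span {u, w}" for u w :: "'a::real_vector"
proof (cases b)
  case True
  have "- w \<in> span {u, w}" "u \<in> span {u, w}" "u \<in> span {u, - w}"
    by (auto intro: span_base span_neg)
  moreover have "w \<in> span {u, - w}"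
    using span_neg[of "- w" "{u, - w}"] span_base[of "- w" "{u, - w}"] by simp
  ultimately have "span {u, - w} = span {u, w}"
    unfolding span_eq by simp
  then show ?thesis using True by simp
qed simp

text \<open>The planes of such a rotation are the reference planes in some order, and in each of
  them only an orientation remains free. Indices with angle pi are kept out of \<open>A\<close>:
  there the sine vanishes, the orientation leaves no trace in the matrix, and allowing both signs
  would destroy injectivity.\<close>

lemma rotation_fibre_bij:
  fixes S :: "real^'n^'n"
  assumes d: "rotation_data S k \<theta> u w" and inj: "inj_on \<theta> {..<k}"
  shows "bij_betw (signed_rot k \<theta> u w)
    ({\<sigma>. \<sigma> permutes {..<k}} \<times> Pow {j. j < k \<and> \<theta> j \<noteq> pi})
    {S'. k_rotation_with_angles S' k \<theta> \<and> eigenplanes k \<theta> S' = eigenplanes k \<theta> S}"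
    (is "bij_betw ?f (?P \<times> Pow ?B) ?F")
proof -
  note o = rotation_data_orthonormal_on[OF d]
  have rng: "0 < \<theta> j \<and> \<theta> j \<le> pi" if "j < k" for j
    using d that unfolding rotation_data_def by blast
  have sd: "rotation_data (?f (\<sigma>, A)) k \<theta> (\<lambda>j. u (\<sigma> j)) (\<lambda>j. (if j \<in> A then -1 else 1) *\<^sub>R w (\<sigma> j))"
    if "\<sigma> permutes {..<k}" for \<sigma> A
    using signed_rot_data[OF o _ that] rng by blast
  have plane: "eigenplane (\<theta> j) (?f (\<sigma>, A)) = span {u (\<sigma> j), w (\<sigma> j)}"
    if "\<sigma> permutes {..<k}" "j < k" for \<sigma> A j
    using eigenplane_eq_span[OF sd[OF that(1)] inj that(2)] by (simp add: span_pair_sign)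
  have "inj_on ?f (?P \<times> Pow ?B)"
  proof (rule inj_onI, clarify)
    fix \<sigma> A \<sigma>' A'
    assume p: "\<sigma> permutes {..<k}" "\<sigma>' permutes {..<k}" and A: "A \<subseteq> ?B" "A' \<subseteq> ?B"
      and eq: "?f (\<sigma>, A) = ?f (\<sigma>', A')"
    have s: "\<sigma> j = \<sigma>' j" if "j < k" for j
    proof (rule span_frame_inj[OF o])
      show "\<sigma> j < k" "\<sigma>' j < k" using permutes_in_image[OF p(1)] permutes_in_image[OF p(2)] that by auto
      show "span {u (\<sigma> j), w (\<sigma> j)} = span {u (\<sigma>' j), w (\<sigma>' j)}"
        using plane[OF p(1) that, of A] plane[OF p(2) that, of A'] eq by simp
    qed
    have "\<sigma> = \<sigma>'"
    proof
      fix j show "\<sigma> j = \<sigma>' j"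
        using s permutes_not_in[OF p(1), of j] permutes_not_in[OF p(2), of j] by (cases "j < k") auto
    qed
    moreover have "j \<in> A \<longleftrightarrow> j \<in> A'" if j: "j \<in> ?B" for j
    proof -
      have jk: "j < k" and "\<sigma> j < k" using j permutes_in_image[OF p(1), of j] by auto
      have "?f (\<sigma>, A) *v u (\<sigma> j) = cos (\<theta> j) *\<^sub>R u (\<sigma> j) + sin (\<theta> j) *\<^sub>R ((if j \<in> A then -1 else 1) *\<^sub>R w (\<sigma> j))"
        using sd[OF p(1), of A] jk unfolding rotation_data_def by blast
      moreover have "?f (\<sigma>', A') *v u (\<sigma>' j) = cos (\<theta> j) *\<^sub>R u (\<sigma>' j) + sin (\<theta> j) *\<^sub>R ((if j \<in> A' then -1 else 1) *\<^sub>R w (\<sigma>' j))"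
        using sd[OF p(2), of A'] jk unfolding rotation_data_def by blast
      ultimately have "sin (\<theta> j) *\<^sub>R ((if j \<in> A then -1 else 1) *\<^sub>R w (\<sigma> j)) = sin (\<theta> j) *\<^sub>R ((if j \<in> A' then -1 else 1) *\<^sub>R w (\<sigma> j))"
        unfolding \<open>\<sigma> = \<sigma>'\<close> eq[unfolded \<open>\<sigma> = \<sigma>'\<close>] by (rule add_left_imp_eq[OF trans[OF sym]])
      \<comment> \<open>The angle lies strictly between 0 and pi because \<open>j\<close> is in
        \<open>?B\<close>; the sign of the quarter turn can therefore be read off the
        matrix.\<close>
      moreover have "sin (\<theta> j) \<noteq> 0"
        using sin_gt_zero[of "\<theta> j"] rng[OF jk] j by fastforce
      moreover have "w (\<sigma> j) \<noteq> 0"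
        using frame_inner(2)[OF o \<open>\<sigma> j < k\<close> \<open>\<sigma> j < k\<close>] by auto
      ultimately show ?thesis by (auto split: if_splits)
    qed
    ultimately show "\<sigma> = \<sigma>' \<and> A = A'" using A by blast
  qed
  moreover have "?f x \<in> ?F" if "x \<in> ?P \<times> Pow ?B" for x
  proof -
    obtain \<sigma> A where x: "x = (\<sigma>, A)" and p: "\<sigma> permutes {..<k}"
      using \<open>x \<in> ?P \<times> Pow ?B\<close> by (cases x) auto
    have "eigenplanes k \<theta> (?f (\<sigma>, A)) = (\<lambda>j. span {u (\<sigma> j), w (\<sigma> j)}) ` {..<k}"
      unfolding eigenplanes_def by (rule image_cong) (use plane[OF p] in auto)
    also have "\<dots> = (\<lambda>j. span {u j, w j}) ` (\<sigma> ` {..<k})"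
      by (simp only: image_image)
    finally have "eigenplanes k \<theta> (?f (\<sigma>, A)) = eigenplanes k \<theta> S"
      by (simp only: permutes_image[OF p] eigenplanes_eq[OF d inj])
    then show ?thesis
      using sd[OF p, of A] x unfolding k_rotation_with_angles_def by blast
  qed
  moreover have "S' \<in> ?f ` (?P \<times> Pow ?B)" if F: "S' \<in> ?F" for S'
  proof -
    obtain u' w' where d': "rotation_data S' k \<theta> u' w'"
      using F by (auto simp: k_rotation_with_angles_def)
    note o' = rotation_data_orthonormal_on[OF d']
    have im: "(\<lambda>j. span {u' j, w' j}) ` {..<k} = (\<lambda>j. span {u j, w j}) ` {..<k}"
      using F eigenplanes_eq[OF d inj] eigenplanes_eq[OF d' inj] by simp
    have "\<exists>i<k. span {u' j, w' j} = span {u i, w i}" if "j < k" for j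
    proof -
      have "span {u' j, w' j} \<in> (\<lambda>j. span {u j, w j}) ` {..<k}"
        unfolding im[symmetric] using that by simp
      then show ?thesis by auto
    qed
    then obtain s where s: "\<And>j. j < k \<Longrightarrow> s j < k" "\<And>j. j < k \<Longrightarrow> span {u' j, w' j} = span {u (s j), w (s j)}"
      by metis
    \<comment> \<open>\<open>s\<close> is only controlled below \<open>k\<close>; the identity
      elsewhere is what \<open>permutes\<close> demands.\<close>
    define \<sigma> where "\<sigma> j = (if j < k then s j else j)" for j
    have "inj_on \<sigma> {..<k}"
    proof (rule inj_onI)
      fix i j assume "i \<in> {..<k}" "j \<in> {..<k}" "\<sigma> i = \<sigma> j"
      then show "i = j"
        using s(2)[of i] s(2)[of j] by (intro span_frame_inj[OF o', of i j]) (auto simp: \<sigma>_def)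
    qed
    then have p: "\<sigma> permutes {..<k}"
      using s(1) endo_inj_surj[of "{..<k}" \<sigma>]
      by (intro bij_imp_permutes) (auto simp: \<sigma>_def bij_betw_def)
    define sgn_ok where "sgn_ok j \<epsilon> \<longleftrightarrow> (\<epsilon> = 1 \<or> \<epsilon> = -1) \<and>
       (\<forall>x. (x \<bullet> u' j) *\<^sub>R u' j + (x \<bullet> w' j) *\<^sub>R w' j = (x \<bullet> u (\<sigma> j)) *\<^sub>R u (\<sigma> j) + (x \<bullet> w (\<sigma> j)) *\<^sub>R w (\<sigma> j)) \<and>
       (\<forall>x. (x \<bullet> u' j) *\<^sub>R w' j - (x \<bullet> w' j) *\<^sub>R u' j
          = \<epsilon> *\<^sub>R ((x \<bullet> u (\<sigma> j)) *\<^sub>R w (\<sigma> j) - (x \<bullet> w (\<sigma> j)) *\<^sub>R u (\<sigma> j)))" for j and \<epsilon> :: real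
    have ex: "\<exists>\<epsilon>. sgn_ok j \<epsilon>" if j: "j < k" for j
    proof -
      have sj: "\<sigma> j < k" using s(1)[OF j] j by (simp add: \<sigma>_def)
      have sp: "span {u' j, w' j} = span {u (\<sigma> j), w (\<sigma> j)}" using s(2)[OF j] j by (simp add: \<sigma>_def)
      have a: "u (\<sigma> j) \<bullet> u (\<sigma> j) = 1" "w (\<sigma> j) \<bullet> w (\<sigma> j) = 1" "u (\<sigma> j) \<bullet> w (\<sigma> j) = 0"
        using frame_inner[OF o sj sj] by auto
      have b: "u' j \<bullet> u' j = 1" "w' j \<bullet> w' j = 1" "u' j \<bullet> w' j = 0"
        using frame_inner[OF o' j j] by auto
      show ?thesis
        unfolding sgn_ok_def by (rule orthonormal_pair_same_span[OF a b sp]) blast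
    qed
    define \<epsilon> where "\<epsilon> j = (SOME e. sgn_ok j e)" for j
    have "sgn_ok j (\<epsilon> j)" if "j < k" for j
      using someI_ex[OF ex[OF that]] unfolding \<epsilon>_def .
    then have \<epsilon>: "\<And>j. j < k \<Longrightarrow> \<epsilon> j = 1 \<or> \<epsilon> j = -1"
      "\<And>j x. j < k \<Longrightarrow> (x \<bullet> u' j) *\<^sub>R u' j + (x \<bullet> w' j) *\<^sub>R w' j = (x \<bullet> u (\<sigma> j)) *\<^sub>R u (\<sigma> j) + (x \<bullet> w (\<sigma> j)) *\<^sub>R w (\<sigma> j)"
      "\<And>j x. j < k \<Longrightarrow> (x \<bullet> u' j) *\<^sub>R w' j - (x \<bullet> w' j) *\<^sub>R u' j
          = \<epsilon> j *\<^sub>R ((x \<bullet> u (\<sigma> j)) *\<^sub>R w (\<sigma> j) - (x \<bullet> w (\<sigma> j)) *\<^sub>R u (\<sigma> j))"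
      unfolding sgn_ok_def by blast+
    \<comment> \<open>At an angle pi the sign \<open>\<epsilon> j\<close> may well be -1, but it is
      dropped: it only ever occurs multiplied by the sine, which is zero there.\<close>
    define A where "A = {j. j < k \<and> \<theta> j \<noteq> pi \<and> \<epsilon> j = -1}"
    define w'' where "w'' j = (if j \<in> A then -1 else 1) *\<^sub>R w (\<sigma> j)" for j
    have "S' *v x = ?f (\<sigma>, A) *v x" for x
    proof -
      have "(cos (\<theta> j) - 1) *\<^sub>R ((x \<bullet> u' j) *\<^sub>R u' j + (x \<bullet> w' j) *\<^sub>R w' j)
          + sin (\<theta> j) *\<^sub>R ((x \<bullet> u' j) *\<^sub>R w' j - (x \<bullet> w' j) *\<^sub>R u' j)
        = (cos (\<theta> j) - 1) *\<^sub>R ((x \<bullet> u (\<sigma> j)) *\<^sub>R u (\<sigma> j) + (x \<bullet> w'' j) *\<^sub>R w'' j)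
          + sin (\<theta> j) *\<^sub>R ((x \<bullet> u (\<sigma> j)) *\<^sub>R w'' j - (x \<bullet> w'' j) *\<^sub>R u (\<sigma> j))" if j: "j < k" for j
      proof -
        have "(x \<bullet> w'' j) *\<^sub>R w'' j = (x \<bullet> w (\<sigma> j)) *\<^sub>R w (\<sigma> j)"
          by (simp add: w''_def)
        moreover have "sin (\<theta> j) *\<^sub>R (\<epsilon> j *\<^sub>R ((x \<bullet> u (\<sigma> j)) *\<^sub>R w (\<sigma> j) - (x \<bullet> w (\<sigma> j)) *\<^sub>R u (\<sigma> j)))
          = sin (\<theta> j) *\<^sub>R ((x \<bullet> u (\<sigma> j)) *\<^sub>R w'' j - (x \<bullet> w'' j) *\<^sub>R u (\<sigma> j))"
        proof (cases "\<theta> j = pi")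
          case False
          then show ?thesis using \<epsilon>(1)[OF j] j by (auto simp: w''_def A_def scaleR_diff_right)
        qed simp
        ultimately show ?thesis by (simp only: \<epsilon>(2,3)[OF j])
      qed
      then have "rot k \<theta> u' w' x = rot k \<theta> (\<lambda>j. u (\<sigma> j)) w'' x"
        unfolding rot_def by (intro arg_cong[where f="(+) x"] sum.cong refl) (simp only: lessThan_iff)
      moreover have "?f (\<sigma>, A) *v x = rot k \<theta> (\<lambda>j. u (\<sigma> j)) w'' x"
        unfolding rotation_data_apply[OF sd[OF p, of A]] w''_def[abs_def] ..
      ultimately show ?thesis
        unfolding rotation_data_apply[OF d'] by simp
    qed
    then have "S' = ?f (\<sigma>, A)" by (simp add: matrix_eq)
    moreover have "(\<sigma>, A) \<in> ?P \<times> Pow ?B" using p by (auto simp: A_def)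
    ultimately show ?thesis by blast
  qed
  ultimately show ?thesis
    unfolding bij_betw_def by blast
qed

text \<open>Injectivity of the angles allows at most one of them to be pi, so at most one factor 2
  is lost.\<close>

lemma card_non_pi:
  assumes "inj_on \<theta> {..<k}"
  shows "2 ^ card {j. j < k \<and> \<theta> j \<noteq> pi} * fact k = d0 k \<theta>"
proof (cases "\<exists>j<k. \<theta> j = pi")
  case True
  then obtain j where j: "j < k" "\<theta> j = pi" by blast
  then have "{j. j < k \<and> \<theta> j \<noteq> pi} = {..<k} - {j}"
    using assms by (auto simp: inj_on_def)
  then show ?thesis using True j by (simp add: d0_def)
next
  case False
  then have "{j. j < k \<and> \<theta> j \<noteq> pi} = {..<k}" by auto
  moreover have "d0 k \<theta> = 2 ^ k * fact k"
    unfolding d0_def using False by (rule if_not_P)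
  ultimately show ?thesis by simp
qed

lemma rotation_fibre_card:
  fixes S :: "real^'n^'n"
  assumes "k_rotation_with_angles S k \<theta>" and inj: "inj_on \<theta> {..<k}"
  shows "finite {S'. k_rotation_with_angles S' k \<theta> \<and> eigenplanes k \<theta> S' = eigenplanes k \<theta> S}" (is "finite ?F")
    "card {S'. k_rotation_with_angles S' k \<theta> \<and> eigenplanes k \<theta> S' = eigenplanes k \<theta> S} = d0 k \<theta>"
proof -
  obtain u w where d: "rotation_data S k \<theta> u w"
    using assms by (auto simp: k_rotation_with_angles_def)
  note b = rotation_fibre_bij[OF d inj]
  have "finite ({\<sigma>. \<sigma> permutes {..<k}} \<times> Pow {j. j < k \<and> \<theta> j \<noteq> pi})"
    by (simp add: finite_permutations)
  then show "finite ?F" using bij_betw_finite[OF b] by blast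
  have "card ?F = card ({\<sigma>. \<sigma> permutes {..<k}} \<times> Pow {j. j < k \<and> \<theta> j \<noteq> pi})"
    using bij_betw_same_card[OF b] by simp
  also have "\<dots> = fact k * 2 ^ card {j. j < k \<and> \<theta> j \<noteq> pi}"
    by (simp add: card_cartesian_product card_permutations[OF card_lessThan] card_Pow)
  also have "\<dots> = d0 k \<theta>" by (subst mult.commute) (rule card_non_pi[OF inj])
  finally show "card ?F = d0 k \<theta>" .
qed

section \<open>Quotients of the orthogonal group and coverings\<close>

lemma openin_quotient_topology:
  "openin (quotient_topology X f) U \<longleftrightarrow> U \<subseteq> f ` topspace X \<and> openin X {x \<in> topspace X. f x \<in> U}"
  unfolding quotient_topology_def by (simp add: topology_inverse'[OF istopology_quotient])

lemma topspace_quotient_topology [simp]: "topspace (quotient_topology X f) = f ` topspace X"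
proof
  have "openin (quotient_topology X f) (topspace (quotient_topology X f))" by simp
  then show "topspace (quotient_topology X f) \<subseteq> f ` topspace X"
    unfolding openin_quotient_topology by blast
  have "{x \<in> topspace X. f x \<in> f ` topspace X} = topspace X" by auto
  then have "openin (quotient_topology X f) (f ` topspace X)"
    unfolding openin_quotient_topology by simp
  then show "f ` topspace X \<subseteq> topspace (quotient_topology X f)"
    by (rule openin_subset)
qed

lemma quotient_map_quotient_topology: "quotient_map X (quotient_topology X f) f"
  unfolding quotient_map_def by (auto simp: openin_quotient_topology)

text \<open>The space of unordered decompositions is a quotient of a quotient; this presents it as a
  single quotient of the orthogonal group.\<close>

lemma quotient_topology_compose:
  "quotient_topology (quotient_topology X f) g = quotient_topology X (\<lambda>x. g (f x))"
proof -
  have "{x \<in> topspace X. f x \<in> {y \<in> f ` topspace X. g y \<in> U}} = {x \<in> topspace X. g (f x) \<in> U}" for U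
    by auto
  then show ?thesis
    unfolding topology_eq openin_quotient_topology topspace_quotient_topology
    by (auto simp: image_image)
qed

lemma tendsto_matrix_mult:
  fixes f :: "'a \<Rightarrow> real^'n^'m" and g :: "'a \<Rightarrow> real^'p^'n"
  assumes "(f \<longlongrightarrow> a) F" "(g \<longlongrightarrow> b) F"
  shows "((\<lambda>x. f x ** g x) \<longlongrightarrow> a ** b) F"
  unfolding matrix_matrix_mult_def
  by (intro tendsto_vec_lambda tendsto_sum tendsto_mult tendsto_vec_nth assms)

lemma tendsto_transpose:
  fixes f :: "'a \<Rightarrow> real^'n^'m"
  assumes "(f \<longlongrightarrow> a) F"
  shows "((\<lambda>x. transpose (f x)) \<longlongrightarrow> transpose a) F"
  unfolding transpose_def by (intro tendsto_vec_lambda tendsto_vec_nth assms)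

text \<open>Closed because it is cut out by a continuous matrix equation, bounded because the rows
  are unit vectors and the norm is at most the sum of the row norms.\<close>

lemma compact_ortho_group: "compact (ortho_group :: (real^'n^'n) set)"
proof -
  have "closed {Q :: real^'n^'n. transpose Q ** Q = mat 1}"
    by (intro closed_Collect_eq) (auto simp: continuous_on_def intro!: tendsto_matrix_mult tendsto_transpose)
  moreover have "bounded {Q :: real^'n^'n. transpose Q ** Q = mat 1}"
  proof (rule boundedI)
    fix Q :: "real^'n^'n" assume "Q \<in> {Q. transpose Q ** Q = mat 1}"
    then have "norm (Q $ i) = 1" for i
      using orthogonal_matrix_orthonormal_rows[of Q] orthogonal_matrix[of Q] by (simp add: row_def)
    then show "norm Q \<le> real CARD('n)"
      using L2_set_le_sum[of UNIV "\<lambda>i. norm (Q $ i)"] by (simp add: norm_vec_def)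
  qed
  ultimately show ?thesis
    unfolding ortho_group_def orthogonal_matrix compact_eq_bounded_closed by simp
qed

text \<open>A continuous surjection from a compact space onto a Hausdorff space is a quotient map.
  The subspace topology of the class is thus also its topology as an orbit, and maps out of the
  class can be tested on the group.\<close>

lemma orbit_quotient_map:
  fixes T :: "real^'n^'n"
  shows "quotient_map (top_of_set ortho_group) (top_of_set (conj_class T)) (\<lambda>g. g ** T ** transpose g)"
proof (rule continuous_imp_quotient_map)
  have im: "(\<lambda>g. g ** T ** transpose g) ` ortho_group = conj_class T"
    unfolding ortho_group_def conj_class_def by blast
  have "continuous_on ortho_group (\<lambda>g. g ** T ** transpose g)"
    unfolding continuous_on_def by (intro ballI tendsto_matrix_mult tendsto_transpose tendsto_const tendsto_ident_at)
  then show "continuous_map (top_of_set ortho_group) (top_of_set (conj_class T)) (\<lambda>g. g ** T ** transpose g)"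
    using im by (auto intro!: continuous_map_into_subtopology)
  show "compact_space (top_of_set (ortho_group :: (real^'n^'n) set))"
    by (rule compact_space_subtopology) (simp add: compact_ortho_group)
  show "Hausdorff_space (top_of_set (conj_class T))"
    by (rule Hausdorff_space_subtopology) simp
  show "(\<lambda>g. g ** T ** transpose g) ` topspace (top_of_set ortho_group) = topspace (top_of_set (conj_class T))"
    using im by simp
qed

lemma orbit_map_continuous:
  fixes T :: "real^'n^'n"
  assumes p: "\<And>g. g \<in> ortho_group \<Longrightarrow> p (g ** T ** transpose g) = \<pi> g"
  shows "continuous_map (top_of_set (conj_class T)) (quotient_topology (top_of_set ortho_group) \<pi>) p"
    "p ` conj_class T = \<pi> ` ortho_group"
proof -
  show "continuous_map (top_of_set (conj_class T)) (quotient_topology (top_of_set ortho_group) \<pi>) p"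
  proof (rule continuous_compose_quotient_map[OF orbit_quotient_map])
    show "continuous_map (top_of_set ortho_group) (quotient_topology (top_of_set ortho_group) \<pi>)
        (p \<circ> (\<lambda>g. g ** T ** transpose g))"
      by (rule continuous_map_eq[OF quotient_imp_continuous_map[OF quotient_map_quotient_topology]])
         (simp add: p)
  qed
  have "conj_class T = (\<lambda>g. g ** T ** transpose g) ` ortho_group"
    unfolding ortho_group_def conj_class_def by blast
  then show "p ` conj_class T = \<pi> ` ortho_group"
    by (simp add: image_image p)
qed

text \<open>By \<open>equiv\<close> the fibres of \<pi> are the cosets \<open>g H\<close> of a
  stabiliser \<open>H\<close>. The preimage under \<pi> of the image of \<open>W\<close> is then the
  union, over \<open>h\<close> in \<open>H\<close>, of right translates of the preimage of
  \<open>W\<close> under the orbit map, and each translate is open.\<close>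

lemma orbit_map_open:
  fixes T :: "real^'n^'n"
  assumes p: "\<And>g. g \<in> ortho_group \<Longrightarrow> p (g ** T ** transpose g) = \<pi> g"
    and equiv: "\<And>a b c. \<lbrakk>a \<in> ortho_group; b \<in> ortho_group; c \<in> ortho_group; \<pi> b = \<pi> c\<rbrakk> \<Longrightarrow> \<pi> (a ** b) = \<pi> (a ** c)"
  shows "open_map (top_of_set (conj_class T)) (quotient_topology (top_of_set ortho_group) \<pi>) p"
  unfolding open_map_def
proof (intro allI impI)
  fix W assume W: "openin (top_of_set (conj_class T)) W"
  let ?q = "\<lambda>g. g ** T ** transpose g"
  let ?O = "ortho_group :: (real^'n^'n) set"
  have sub: "W \<subseteq> conj_class T" using W openin_subset by fastforce
  have conj: "conj_class T = ?q ` ?O"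
    unfolding ortho_group_def conj_class_def by blast
  have mult: "a ** b \<in> ?O" if "a \<in> ?O" "b \<in> ?O" for a b
    using that by (simp add: ortho_group_def orthogonal_matrix_mul)
  have contq: "continuous_map (top_of_set ?O) (top_of_set (conj_class T)) ?q"
    by (rule quotient_imp_continuous_map[OF orbit_quotient_map])
  define H where "H = {h \<in> ?O. \<forall>g\<in>?O. \<pi> (g ** h) = \<pi> g}"
  have "{g \<in> ?O. \<pi> g \<in> p ` W} = (\<Union>h\<in>H. {g \<in> ?O. ?q (g ** h) \<in> W})"
  proof (intro equalityI subsetI)
    fix g assume "g \<in> {g \<in> ?O. \<pi> g \<in> p ` W}"
    then obtain S where g: "g \<in> ?O" and S: "S \<in> W" "\<pi> g = p S" by blast
    obtain g' where g': "g' \<in> ?O" "S = ?q g'" using S(1) sub conj by blast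
    \<comment> \<open>The element taking \<open>g\<close> to \<open>g'\<close> by right
      multiplication. Applying \<open>equiv\<close> with the left factor
      \<open>a ** transpose g\<close> shows that it stabilises every value of \<pi>.\<close>
    define h where "h = transpose g ** g'"
    have tg: "transpose g \<in> ?O" using g by (simp add: ortho_group_def)
    have gh: "g ** h = g'"
      using g unfolding h_def by (simp add: matrix_mul_assoc ortho_group_def orthogonal_matrix_def)
    have "\<pi> g' = \<pi> g" using S(2) g' p by simp
    have "\<pi> (a ** h) = \<pi> a" if "a \<in> ?O" for a
    proof -
      have "\<pi> ((a ** transpose g) ** g') = \<pi> ((a ** transpose g) ** g)"
        using equiv[OF mult[OF that tg] g'(1) g \<open>\<pi> g' = \<pi> g\<close>] .
      moreover have "(a ** transpose g) ** g' = a ** h"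
        unfolding h_def by (simp only: matrix_mul_assoc)
      moreover have "(a ** transpose g) ** g = a"
        using g unfolding matrix_mul_assoc[symmetric] by (simp add: ortho_group_def orthogonal_matrix_def)
      ultimately show ?thesis by simp
    qed
    moreover have "h \<in> ?O" unfolding h_def by (rule mult[OF tg g'(1)])
    ultimately have "h \<in> H" by (simp add: H_def)
    then show "g \<in> (\<Union>h\<in>H. {g \<in> ?O. ?q (g ** h) \<in> W})"
      using g S(1) g'(2) gh by auto
  next
    fix g assume "g \<in> (\<Union>h\<in>H. {g \<in> ?O. ?q (g ** h) \<in> W})"
    then obtain h where h: "h \<in> ?O" "\<forall>g\<in>?O. \<pi> (g ** h) = \<pi> g" and g: "g \<in> ?O" "?q (g ** h) \<in> W"
      unfolding H_def by blast
    have "p (?q (g ** h)) = \<pi> g" using p[OF mult[OF g(1) h(1)]] h(2) g(1) by simp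
    then show "g \<in> {g \<in> ?O. \<pi> g \<in> p ` W}"
      using g by (metis (mono_tags, lifting) image_eqI mem_Collect_eq)
  qed
  moreover have "openin (top_of_set ?O) {g \<in> ?O. ?q (g ** h) \<in> W}" if "h \<in> H" for h
  proof -
    have h: "h \<in> ?O" using that by (simp add: H_def)
    have "continuous_on ?O (\<lambda>g. g ** h)"
      unfolding continuous_on_def by (intro ballI tendsto_matrix_mult tendsto_const tendsto_ident_at)
    then have "continuous_map (top_of_set ?O) (top_of_set ?O) (\<lambda>g. g ** h)"
      using mult h by (auto intro!: continuous_map_into_subtopology)
    from openin_continuous_map_preimage[OF continuous_map_compose[OF this contq] W]
    show ?thesis by simp
  qed
  ultimately have "openin (top_of_set ?O) {g \<in> ?O. \<pi> g \<in> p ` W}"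
    by auto
  moreover have "p ` W \<subseteq> \<pi> ` ?O"
    using sub orbit_map_continuous(2)[of p T \<pi>, OF p] by blast
  ultimately show "openin (quotient_topology (top_of_set ?O) \<pi>) (p ` W)"
    unfolding openin_quotient_topology by simp
qed

section \<open>Coverings from open maps with finite fibres of constant size\<close>

lemma Hausdorff_space_finite_separation:
  assumes H: "Hausdorff_space X" and F: "finite F" "F \<subseteq> topspace X"
  obtains W where "\<And>x. x \<in> F \<Longrightarrow> openin X (W x) \<and> x \<in> W x"
    "\<And>x y. x \<in> F \<Longrightarrow> y \<in> F \<Longrightarrow> x \<noteq> y \<Longrightarrow> disjnt (W x) (W y)"
proof -
  have "\<exists>U V. openin X U \<and> openin X V \<and> x \<in> U \<and> y \<in> V \<and> disjnt U V"
    if "x \<in> F" "y \<in> F" "x \<noteq> y" for x y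
    using H F that unfolding Hausdorff_space_def by blast
  then obtain U V where UV: "\<And>x y. x \<in> F \<Longrightarrow> y \<in> F \<Longrightarrow> x \<noteq> y \<Longrightarrow>
      openin X (U x y) \<and> openin X (V x y) \<and> x \<in> U x y \<and> y \<in> V x y \<and> disjnt (U x y) (V x y)"
    by metis
  \<comment> \<open>The chosen separation of \<open>x\<close> from \<open>y\<close> need not be the
    one of \<open>y\<close> from \<open>x\<close>, so both are intersected. The factor
    \<open>topspace X\<close> covers a one-point \<open>F\<close>, where the intersection is over
    the empty set.\<close>
  define W where "W x = topspace X \<inter> (\<Inter>y\<in>F - {x}. U x y \<inter> V y x)" for x
  show ?thesis
  proof
    fix x assume x: "x \<in> F"
    have "openin X (topspace X \<inter> \<Inter> ((\<lambda>y. U x y \<inter> V y x) ` (F - {x})))"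
    proof (cases "F - {x} = {}")
      case False
      then show ?thesis
        using F(1) UV x by (intro openin_Int openin_INT2 openin_topspace) auto
    qed (simp only: image_empty Inter_empty Int_UNIV_right openin_topspace)
    then show "openin X (W x) \<and> x \<in> W x"
      using UV x F(2) unfolding W_def by blast
  next
    fix x y assume "x \<in> F" "y \<in> F" "x \<noteq> y"
    then show "disjnt (W x) (W y)"
      using UV[of x y] unfolding W_def disjnt_def by blast
  qed
qed

text \<open>Once every nearby fibre meets each of the \<open>d\<close> disjoint neighbourhoods of the points of one
  fibre, counting forces it to meet each of them exactly once.\<close>
lemma sheeted_covering_if_open_map:
  assumes cont: "continuous_map E B p" and op: "open_map E B p" and surj: "p ` topspace E = topspace B"
    and H: "Hausdorff_space E"
    and fib: "\<And>b. b \<in> topspace B \<Longrightarrow> finite {x \<in> topspace E. p x = b} \<and> card {x \<in> topspace E. p x = b} = d"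
  shows "sheeted_covering d E B p"
  unfolding sheeted_covering_def covering_map_top_def
proof (intro conjI ballI cont surj)
  fix b assume b: "b \<in> topspace B"
  show "finite {x \<in> topspace E. p x = b}" "card {x \<in> topspace E. p x = b} = d"
    using fib[OF b] by auto
  let ?F = "{x \<in> topspace E. p x = b}"
  obtain W where W: "\<And>x. x \<in> ?F \<Longrightarrow> openin E (W x) \<and> x \<in> W x"
    and Wd: "\<And>x y. x \<in> ?F \<Longrightarrow> y \<in> ?F \<Longrightarrow> x \<noteq> y \<Longrightarrow> disjnt (W x) (W y)"
    using Hausdorff_space_finite_separation[OF H, of ?F] fib[OF b] by blast
  \<comment> \<open>The points of the base whose fibre meets every \<open>W x\<close>. It is open as
    a finite intersection of open images; surjectivity makes the index set nonempty.\<close>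
  define U where "U = (\<Inter>x\<in>?F. p ` W x)"
  have ne: "?F \<noteq> {}" using b unfolding surj[symmetric] by blast
  have bU: "b \<in> U"
    unfolding U_def using W by force
  have oU: "openin B U"
    unfolding U_def using ne fib[OF b] W op by (intro openin_INT2) (auto simp: open_map_def)
  define V where "V x = W x \<inter> {z \<in> topspace E. p z \<in> U}" for x
  have oV: "openin E (V x)" if "x \<in> ?F" for x
    unfolding V_def using W[OF that] openin_continuous_map_preimage[OF cont oU] by (intro openin_Int) auto
  \<comment> \<open>A choice of one point over \<open>c\<close> in each \<open>W x\<close> is
    injective by disjointness, and as both fibres have \<open>d\<close> points it exhausts the fibre
    over \<open>c\<close>.\<close>
  have key: "\<exists>s. inj_on s ?F \<and> (\<forall>x\<in>?F. s x \<in> W x) \<and> s ` ?F = {z \<in> topspace E. p z = c}" if c: "c \<in> U" for c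
  proof -
    have "\<exists>z. z \<in> W x \<and> p z = c" if "x \<in> ?F" for x
      using c that unfolding U_def by blast
    then obtain s where s: "\<And>x. x \<in> ?F \<Longrightarrow> s x \<in> W x \<and> p (s x) = c" by metis
    have inj: "inj_on s ?F"
    proof (rule inj_onI, rule ccontr)
      fix x y assume *: "x \<in> ?F" "y \<in> ?F" "s x = s y" "x \<noteq> y"
      have "s x \<in> W x" "s x \<in> W y" using s[OF *(1)] s[OF *(2)] *(3) by auto
      then show False using Wd[OF *(1,2,4)] unfolding disjnt_def by blast
    qed
    have cB: "c \<in> topspace B" using c oU openin_subset by blast
    have "s ` ?F \<subseteq> {z \<in> topspace E. p z = c}"
    proof
      fix z assume "z \<in> s ` ?F"
      then obtain x where x: "x \<in> ?F" "z = s x" by blast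
      then show "z \<in> {z \<in> topspace E. p z = c}"
        using s[OF x(1)] W[OF x(1)] openin_subset by blast
    qed
    then have "s ` ?F = {z \<in> topspace E. p z = c}"
      using fib[OF cB] fib[OF b] card_image[OF inj] by (intro card_subset_eq) auto
    then show ?thesis using inj s by blast
  qed
  have Un: "\<Union> (V ` ?F) = {x \<in> topspace E. p x \<in> U}"
  proof (intro equalityI subsetI)
    fix z assume z: "z \<in> {x \<in> topspace E. p x \<in> U}"
    obtain s where s: "\<forall>x\<in>?F. s x \<in> W x" "s ` ?F = {y \<in> topspace E. p y = p z}"
      using key[of "p z"] z by auto
    have "z \<in> s ` ?F" using z unfolding s(2) by simp
    then obtain x where "x \<in> ?F" "z \<in> W x" using s(1) by blast
    then show "z \<in> \<Union> (V ` ?F)" using z unfolding V_def by blast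
  qed (auto simp: V_def)
  have "homeomorphic_map (subtopology E (V x)) (subtopology B U) p" if x: "x \<in> ?F" for x
  proof (rule bijective_open_imp_homeomorphic_map)
    have VE: "V x \<subseteq> topspace E" and UB: "U \<subseteq> topspace B"
      using openin_subset[OF oV[OF x]] openin_subset[OF oU] by auto
    have pV: "p ` V x \<subseteq> U" by (auto simp: V_def)
    show "continuous_map (subtopology E (V x)) (subtopology B U) p"
      using pV by (intro continuous_map_into_subtopology continuous_map_from_subtopology cont) auto
    show "open_map (subtopology E (V x)) (subtopology B U) p"
      unfolding open_map_def openin_open_subtopology[OF oV[OF x]] openin_open_subtopology[OF oU]
      using op pV unfolding open_map_def by blast
    have "U \<subseteq> p ` V x"
    proof
      fix c assume c: "c \<in> U"
      then obtain z where z: "z \<in> W x" "c = p z" using x unfolding U_def by blast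
      moreover have "z \<in> topspace E" using W[OF x] openin_subset z(1) by blast
      ultimately show "c \<in> p ` V x" using c unfolding V_def by blast
    qed
    then show "p ` topspace (subtopology E (V x)) = topspace (subtopology B U)"
      using pV VE UB by (simp add: Int_absorb1 subset_antisym)
    have "inj_on p (V x)"
    proof (rule inj_onI)
      fix y z assume yz: "y \<in> V x" "z \<in> V x" "p y = p z"
      obtain s where s: "\<forall>x\<in>?F. s x \<in> W x" "s ` ?F = {v \<in> topspace E. p v = p y}"
        using key[of "p y"] yz(1) unfolding V_def by auto
      \<comment> \<open>A point over \<open>p y\<close> is some \<open>s x'\<close>, which lies in
        \<open>W x'\<close>; being in \<open>W x\<close> as well, it forces
        \<open>x' = x\<close>.\<close>
      have "v = s x" if "v \<in> V x" "p v = p y" for v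
      proof -
        have "v \<in> s ` ?F" using that unfolding s(2) V_def by blast
        then obtain x' where x': "x' \<in> ?F" "v = s x'" by blast
        then have "v \<in> W x'" "v \<in> W x" using s(1) that unfolding V_def by auto
        then have "x' = x" using Wd[OF x'(1) x] unfolding disjnt_def by blast
        then show ?thesis using x' by simp
      qed
      then show "y = z" using yz by metis
    qed
    then show "inj_on p (topspace (subtopology E (V x)))"
      using VE by (simp add: Int_absorb1)
  qed
  moreover have "pairwise disjnt (V ` ?F)"
  proof (rule pairwiseI)
    fix P Q assume "P \<in> V ` ?F" "Q \<in> V ` ?F" "P \<noteq> Q"
    then obtain x y where "x \<in> ?F" "y \<in> ?F" "x \<noteq> y" "P = V x" "Q = V y" by blast
    then show "disjnt P Q" using Wd[of x y] unfolding V_def disjnt_def by blast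
  qed
  moreover have "\<forall>P\<in>V ` ?F. openin E P" using oV by blast
  ultimately show "\<exists>U. b \<in> U \<and> openin B U \<and> (\<exists>\<V>. \<Union>\<V> = {x \<in> topspace E. p x \<in> U} \<and>
      (\<forall>V\<in>\<V>. openin E V) \<and> pairwise disjnt \<V> \<and>
      (\<forall>V\<in>\<V>. homeomorphic_map (subtopology E V) (subtopology B U) p))"
    using bU oU Un by (intro exI[of _ U] conjI exI[of _ "V ` ?F"]) blast+
qed

section \<open>Ordered orthogonal decompositions\<close>

lemma subspace_orthonormal_basis:
  fixes S :: "'a::euclidean_space set"
  assumes "subspace S" "finite I" "dim S = card I"
  obtains e where "orthonormal_on I e" "span (e ` I) = S"
proof -
  obtain B where B: "pairwise orthogonal B" "\<And>x. x \<in> B \<Longrightarrow> norm x = 1" "independent B" "card B = dim S" "span B = S"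
    using orthonormal_basis_subspace[OF assms(1)] by metis
  obtain e where e: "bij_betw e I B"
    using finite_same_card_bij[OF assms(2) independent_imp_finite[OF B(3)]] B(4) assms(3) by auto
  have "e i \<bullet> e j = (if i = j then 1 else 0)" if "i \<in> I" "j \<in> I" for i j
  proof (cases "i = j")
    case True
    then show ?thesis using B(2)[of "e i"] bij_betwE[OF e] that by (simp add: norm_eq_1)
  next
    case False
    then have "e i \<noteq> e j" using bij_betw_imp_inj_on[OF e] that by (auto dest: inj_onD)
    then show ?thesis using B(1) bij_betwE[OF e] that False by (auto simp: pairwise_def orthogonal_def)
  qed
  then have "orthonormal_on I e" by (simp add: orthonormal_on_def)
  moreover have "span (e ` I) = S" using bij_betw_imp_surj_on[OF e] B(5) by simp
  ultimately show ?thesis using that by blast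
qed

lemma frame_plane_dim:
  fixes u w :: "nat \<Rightarrow> 'a::euclidean_space"
  assumes o: "orthonormal_on ({..<k} \<times> UNIV) (frame u w)" and "j < k"
  shows "dim (span {u j, w j}) = 2"
proof -
  have "orthonormal_on ({j} \<times> UNIV) (frame u w)" using o \<open>j < k\<close> by (simp add: orthonormal_on_def)
  moreover have "frame u w ` ({j} \<times> UNIV) = {u j, w j}" by (auto simp: frame_def UNIV_bool)
  ultimately show ?thesis using orthonormal_on_dim_span[of "{j} \<times> (UNIV :: bool set)" "frame u w"]
    by (simp add: card_cartesian_product)
qed

lemma span_pair_orthogonal:
  assumes "x \<in> span {a, b}" "y \<in> span {c, d}" "a \<bullet> c = 0" "a \<bullet> d = 0" "b \<bullet> c = 0" "b \<bullet> d = 0"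
  shows "x \<bullet> y = 0"
proof -
  have "a \<bullet> y = 0" by (rule span_orthogonal[OF _ assms(2)]) (use assms in auto)
  moreover have "b \<bullet> y = 0" by (rule span_orthogonal[OF _ assms(2)]) (use assms in auto)
  ultimately have "y \<bullet> x = 0"
    by (intro span_orthogonal[OF _ assms(1)]) (auto simp: inner_commute[of y])
  then show ?thesis by (simp add: inner_commute)
qed

text \<open>A frame of \<open>2 * k\<close> vectors spans the whole space. Beyond \<open>k\<close>
  the value is the empty set, the default by which \<open>ord_decomps\<close> makes decompositions
  equal as functions.\<close>

lemma frame_planes_ord_decomps:
  fixes u w :: "nat \<Rightarrow> real^'n"
  assumes o: "orthonormal_on ({..<k} \<times> UNIV) (frame u w)" and card: "CARD('n) = 2 * k"
  shows "(\<lambda>j. if j < k then span {u j, w j} else {}) \<in> ord_decomps k"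
proof -
  have "x \<bullet> y = 0" if "i < k" "j < k" "i \<noteq> j" "x \<in> span {u i, w i}" "y \<in> span {u j, w j}" for i j x y
    using span_pair_orthogonal[OF that(4,5)] frame_inner[OF o that(1,2)] that(3) by simp
  moreover have "span (\<Union>j<k. if j < k then span {u j, w j} else {}) = (UNIV :: (real^'n) set)"
  proof -
    have "dim (span (frame u w ` ({..<k} \<times> UNIV))) = DIM(real^'n)"
      unfolding orthonormal_on_dim_span[OF o] by (simp add: card_cartesian_product card)
    then have "span (frame u w ` ({..<k} \<times> UNIV)) = UNIV"
      by (simp only: dim_span dim_eq_full)
    moreover have "frame u w ` ({..<k} \<times> UNIV) \<subseteq> (\<Union>j<k. if j < k then span {u j, w j} else {})"
    proof clarify
      fix j b assume "j < k"
      have "frame u w (j, b) \<in> span {u j, w j}" by (cases b) (auto intro: span_base)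
      then show "frame u w (j, b) \<in> (\<Union>j<k. if j < k then span {u j, w j} else {})"
        using \<open>j < k\<close> by (intro UN_I[of j]) auto
    qed
    from span_mono[OF this] calculation show ?thesis by auto
  qed
  ultimately show ?thesis
    unfolding ord_decomps_def using frame_plane_dim[OF o] by auto
qed

lemma ord_decomps_frame:
  fixes V :: "nat \<Rightarrow> (real^'n) set"
  assumes V: "V \<in> ord_decomps k"
  obtains u w where "orthonormal_on ({..<k} \<times> UNIV) (frame u w)" "\<And>j. j < k \<Longrightarrow> V j = span {u j, w j}"
proof -
  have ex: "\<exists>e :: bool \<Rightarrow> real^'n. orthonormal_on UNIV e \<and> span (range e) = V j" if "j < k" for j
  proof -
    have "subspace (V j)" "dim (V j) = card (UNIV :: bool set)"
      using V that unfolding ord_decomps_def by auto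
    from subspace_orthonormal_basis[OF this(1) finite this(2)] show ?thesis by blast
  qed
  define e where "e j = (SOME e :: bool \<Rightarrow> real^'n. orthonormal_on UNIV e \<and> span (range e) = V j)" for j
  have e: "orthonormal_on UNIV (e j)" "span (range (e j)) = V j" if "j < k" for j
    using someI_ex[OF ex[OF that]] unfolding e_def by blast+
  define u w where "u j = e j False" and "w j = e j True" for j
  have V': "V j = span {u j, w j}" if "j < k" for j
    using e(2)[OF that] by (simp add: u_def w_def UNIV_bool)
  have mem: "u j \<in> V j" "w j \<in> V j" if "j < k" for j
    unfolding V'[OF that] by (auto intro: span_base)
  have orth: "x \<bullet> y = 0" if "i < k" "j < k" "i \<noteq> j" "x \<in> V i" "y \<in> V j" for i j x y
    using V that unfolding ord_decomps_def by blast
  have "orthonormal_on ({..<k} \<times> UNIV) (frame u w)"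
  proof (rule orthonormal_on_frameI)
    fix i j assume ij: "i < k" "j < k"
    show "u i \<bullet> u j = (if i = j then 1 else 0)" "w i \<bullet> w j = (if i = j then 1 else 0)" "u i \<bullet> w j = 0"
      using orthonormal_on_inner[OF e(1)[OF ij(1)]] orth[OF ij] mem[OF ij(1)] mem[OF ij(2)]
      unfolding u_def w_def by (cases "i = j"; simp)+
  qed
  then show ?thesis using V' that by blast
qed

lemma image_span_pair:
  fixes g :: "real^'n^'m"
  shows "(\<lambda>x. g *v x) ` span {a, b} = span {g *v a, g *v b}"
  using linear_span_image[OF matrix_vector_mul_linear, of g "{a, b}"] by simp

text \<open>The given rotation supplies a decomposition, so the choice by \<open>SOME\<close> is a
  genuine one; a rotation adapted to the chosen decomposition then takes over as base point of the
  class.\<close>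

theorem conj_class_covering:
  fixes T :: "real^'n^'n"
  assumes T: "k_rotation_with_angles T k \<theta>" and inj: "inj_on \<theta> {..<k}" and card: "CARD('n) = 2 * k"
  shows "sheeted_covering (d0 k \<theta>) (top_of_set (conj_class T))
    (dfrak_top k :: (real^'n) set set topology) (eigenplanes k \<theta>)"
proof -
  let ?O = "ortho_group :: (real^'n^'n) set"
  obtain u w where d: "rotation_data T k \<theta> u w"
    using T by (auto simp: k_rotation_with_angles_def)
  have rng: "0 < \<theta> j \<and> \<theta> j \<le> pi" if "j < k" for j
    using d that unfolding rotation_data_def by blast
  define V0 :: "nat \<Rightarrow> (real^'n) set" where "V0 = (SOME V. V \<in> ord_decomps k)"
  have "V0 \<in> ord_decomps k"
    unfolding V0_def using frame_planes_ord_decomps[OF rotation_data_orthonormal_on[OF d] card]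
    by (rule someI[of "\<lambda>V. V \<in> ord_decomps k"])
  then obtain u0 w0 where o: "orthonormal_on ({..<k} \<times> UNIV) (frame u0 w0)" and V0: "\<And>j. j < k \<Longrightarrow> V0 j = span {u0 j, w0 j}"
    using ord_decomps_frame by metis
  define T0 where "T0 = matrix (rot k \<theta> u0 w0)"
  have data0: "rotation_data T0 k \<theta> u0 w0"
    unfolding T0_def by (rule rotation_data_rot[OF o rng])
  then have T0: "k_rotation_with_angles T0 k \<theta>"
    by (auto simp: k_rotation_with_angles_def)
  have cc: "conj_class T = conj_class T0"
    unfolding conj_class_eq[OF T] conj_class_eq[OF T0] ..
  define \<pi> :: "real^'n^'n \<Rightarrow> (real^'n) set set" where "\<pi> g = act_decomp g V0 ` {..<k}" for g
  have top: "dfrak_top k = quotient_topology (top_of_set ?O) \<pi>"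
    unfolding dfrak_top_def sfrak_top_def quotient_topology_compose \<pi>_def[abs_def] V0_def ..
  have p: "eigenplanes k \<theta> (g ** T0 ** transpose g) = \<pi> g" if "g \<in> ?O" for g
    using eigenplanes_eq[OF rotation_data_conj[OF data0] inj] that
    by (simp add: ortho_group_def \<pi>_def act_decomp_def V0 image_span_pair)
  \<comment> \<open>Left multiplication acts on sets of planes, so the value at a product depends
    only on the left factor and on the value at the right factor.\<close>
  have equiv: "\<pi> (a ** b) = \<pi> (a ** c)" if "\<pi> b = \<pi> c" for a b c
  proof -
    have "\<pi> (a ** g) = (\<lambda>X. (\<lambda>x. a *v x) ` X) ` \<pi> g" for g
      unfolding \<pi>_def act_decomp_def by (simp add: image_image matrix_vector_mul_assoc)
    then show ?thesis using that by simp
  qed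
  show ?thesis
    unfolding cc top
  proof (rule sheeted_covering_if_open_map)
    show "continuous_map (top_of_set (conj_class T0)) (quotient_topology (top_of_set ?O) \<pi>) (eigenplanes k \<theta>)"
      by (rule orbit_map_continuous(1)[of "eigenplanes k \<theta>" T0 \<pi>, OF p])
    show "open_map (top_of_set (conj_class T0)) (quotient_topology (top_of_set ?O) \<pi>) (eigenplanes k \<theta>)"
      by (rule orbit_map_open[of "eigenplanes k \<theta>" T0 \<pi>, OF p equiv])
    show im: "eigenplanes k \<theta> ` topspace (top_of_set (conj_class T0)) = topspace (quotient_topology (top_of_set ?O) \<pi>)"
      using orbit_map_continuous(2)[of "eigenplanes k \<theta>" T0 \<pi>, OF p] by simp
    show "Hausdorff_space (top_of_set (conj_class T0))"
      by (rule Hausdorff_space_subtopology) simp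
    fix b assume "b \<in> topspace (quotient_topology (top_of_set ?O) \<pi>)"
    then obtain S where S: "S \<in> conj_class T0" "b = eigenplanes k \<theta> S"
      unfolding im[symmetric] by auto
    then have "k_rotation_with_angles S k \<theta>"
      unfolding conj_class_eq[OF T0] by simp
    note rotation_fibre_card[OF this inj]
    moreover have "{x \<in> topspace (top_of_set (conj_class T0)). eigenplanes k \<theta> x = b} =
        {S'. k_rotation_with_angles S' k \<theta> \<and> eigenplanes k \<theta> S' = eigenplanes k \<theta> S}"
      unfolding conj_class_eq[OF T0] S(2) by simp
    ultimately show "finite {x \<in> topspace (top_of_set (conj_class T0)). eigenplanes k \<theta> x = b} \<and>
      card {x \<in> topspace (top_of_set (conj_class T0)). eigenplanes k \<theta> x = b} = d0 k \<theta>"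
      by simp
  qed
qed

section \<open>Continuous Gram-Schmidt and projections\<close>

lemma continuous_map_euclidean_atin:
  "continuous_map X euclidean f \<longleftrightarrow> (\<forall>x\<in>topspace X. (f \<longlongrightarrow> f x) (atin X x))"
  by (simp add: continuous_map_atin)

lemma continuous_map_matrix_mult:
  fixes f :: "'a \<Rightarrow> real^'n^'m" and g :: "'a \<Rightarrow> real^'p^'n"
  assumes "continuous_map X euclidean f" "continuous_map X euclidean g"
  shows "continuous_map X euclidean (\<lambda>x. f x ** g x)"
  using assms unfolding continuous_map_euclidean_atin by (intro ballI tendsto_matrix_mult) auto

lemma continuous_map_transpose:
  fixes f :: "'a \<Rightarrow> real^'n^'m"
  assumes "continuous_map X euclidean f"
  shows "continuous_map X euclidean (\<lambda>x. transpose (f x))"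
  using assms unfolding continuous_map_euclidean_atin by (intro ballI tendsto_transpose) auto

text \<open>Coefficients are attached to indices rather than to vectors, so repeated values of
  \<open>f\<close> do no harm and the relation can be compared with independence of a
  family.\<close>

lemma span_image_expand:
  assumes "finite I" "y \<in> span (f ` I)"
  shows "\<exists>c. y = (\<Sum>i\<in>I. c i *\<^sub>R f i)"
proof -
  have "subspace {y. \<exists>c. y = (\<Sum>i\<in>I. c i *\<^sub>R f i)}"
  proof (rule subspaceI)
    show "0 \<in> {y. \<exists>c. y = (\<Sum>i\<in>I. c i *\<^sub>R f i)}"
      by (auto intro!: exI[of _ "\<lambda>_. 0"])
    fix x y a assume "x \<in> {y. \<exists>c. y = (\<Sum>i\<in>I. c i *\<^sub>R f i)}"
    then obtain c where c: "x = (\<Sum>i\<in>I. c i *\<^sub>R f i)" by blast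
    show "a *\<^sub>R x \<in> {y. \<exists>c. y = (\<Sum>i\<in>I. c i *\<^sub>R f i)}"
      by (auto intro!: exI[of _ "\<lambda>i. a * c i"] simp: c scaleR_sum_right)
    assume "y \<in> {y. \<exists>c. y = (\<Sum>i\<in>I. c i *\<^sub>R f i)}"
    then obtain d where d: "y = (\<Sum>i\<in>I. d i *\<^sub>R f i)" by blast
    show "x + y \<in> {y. \<exists>c. y = (\<Sum>i\<in>I. c i *\<^sub>R f i)}"
      by (auto intro!: exI[of _ "\<lambda>i. c i + d i"] simp: c d scaleR_add_left sum.distrib)
  qed
  moreover have "f ` I \<subseteq> {y. \<exists>c. y = (\<Sum>i\<in>I. c i *\<^sub>R f i)}"
  proof clarify
    fix j assume "j \<in> I"
    have "(\<Sum>i\<in>I. (if i = j then 1 else 0) *\<^sub>R f i) = (\<Sum>i\<in>I. if i = j then f i else 0)"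
      by (rule sum.cong) auto
    then have "f j = (\<Sum>i\<in>I. (if i = j then 1 else 0) *\<^sub>R f i)"
      using assms(1) \<open>j \<in> I\<close> by simp
    then show "\<exists>c. f j = (\<Sum>i\<in>I. c i *\<^sub>R f i)"
      by (rule exI[of _ "\<lambda>i. if i = j then 1 else 0"])
  qed
  ultimately have "span (f ` I) \<subseteq> {y. \<exists>c. y = (\<Sum>i\<in>I. c i *\<^sub>R f i)}"
    by (rule span_minimal[rotated])
  then show ?thesis using assms(2) by blast
qed

text \<open>Pointwise independence keeps each residual away from zero, so normalising it stays
  continuous. Spans are recorded because orthogonality to a subspace has to pass from the
  \<open>v i\<close> to the \<open>e i\<close>.\<close>

lemma continuous_gram_schmidt:
  fixes v :: "'i \<Rightarrow> 'a \<Rightarrow> 'b::euclidean_space"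
  assumes "finite I" "\<And>i. i \<in> I \<Longrightarrow> continuous_map X euclidean (v i)"
    "\<And>x c. x \<in> topspace X \<Longrightarrow> (\<Sum>i\<in>I. c i *\<^sub>R v i x) = 0 \<Longrightarrow> \<forall>i\<in>I. c i = 0"
  shows "\<exists>e. (\<forall>i\<in>I. continuous_map X euclidean (e i)) \<and>
    (\<forall>x\<in>topspace X. orthonormal_on I (\<lambda>i. e i x) \<and> (\<forall>i\<in>I. e i x \<in> span ((\<lambda>i. v i x) ` I)))"
  using assms
proof (induction I rule: finite_induct)
  case empty
  show ?case by (simp add: orthonormal_on_def)
next
  case (insert a I)
  have "\<forall>i\<in>I. c i = 0" if "x \<in> topspace X" "(\<Sum>i\<in>I. c i *\<^sub>R v i x) = 0" for x c
  proof -
    let ?d = "\<lambda>i. if i = a then 0 else c i"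
    have "(\<Sum>i\<in>I. ?d i *\<^sub>R v i x) = (\<Sum>i\<in>I. c i *\<^sub>R v i x)"
      by (rule sum.cong) (use insert.hyps in auto)
    then have "(\<Sum>i\<in>insert a I. ?d i *\<^sub>R v i x) = 0"
      using insert.hyps that(2) by simp
    from insert.prems(2)[OF that(1) this] show ?thesis
      using insert.hyps(2) by (metis insertCI)
  qed
  then have "\<exists>e. (\<forall>i\<in>I. continuous_map X euclidean (e i)) \<and>
    (\<forall>x\<in>topspace X. orthonormal_on I (\<lambda>i. e i x) \<and> (\<forall>i\<in>I. e i x \<in> span ((\<lambda>i. v i x) ` I)))"
    using insert.IH insert.prems(1) by blast
  then obtain e where ec: "\<And>i. i \<in> I \<Longrightarrow> continuous_map X euclidean (e i)"
    and eo: "\<And>x. x \<in> topspace X \<Longrightarrow> orthonormal_on I (\<lambda>i. e i x)"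
    and es: "\<And>x i. x \<in> topspace X \<Longrightarrow> i \<in> I \<Longrightarrow> e i x \<in> span ((\<lambda>i. v i x) ` I)"
    by blast
  define r where "r x = v a x - (\<Sum>i\<in>I. (v a x \<bullet> e i x) *\<^sub>R e i x)" for x
  define e' where "e' i = (if i = a then (\<lambda>x. r x /\<^sub>R norm (r x)) else e i)" for i
  have ri: "r x \<bullet> e i x = 0" if "x \<in> topspace X" "i \<in> I" for x i
    unfolding r_def using orthonormal_on_residual_inner[OF eo[OF that(1)] insert.hyps(1) that(2)] .
  have r0: "r x \<noteq> 0" if x: "x \<in> topspace X" for x
  proof
    assume "r x = 0"
    then have "v a x = (\<Sum>i\<in>I. (v a x \<bullet> e i x) *\<^sub>R e i x)" by (simp only: r_def right_minus_eq)
    moreover have "(\<Sum>i\<in>I. (v a x \<bullet> e i x) *\<^sub>R e i x) \<in> span ((\<lambda>i. v i x) ` I)"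
      by (intro span_sum span_scale es x)
    ultimately have "v a x \<in> span ((\<lambda>i. v i x) ` I)" by (simp only:)
    from span_image_expand[OF insert.hyps(1) this] obtain c where c: "v a x = (\<Sum>i\<in>I. c i *\<^sub>R v i x)"
      by blast
    \<comment> \<open>A vanishing residual would give a relation with coefficient -1 at the new
      index, against independence.\<close>
    let ?d = "\<lambda>i. if i = a then - 1 else c i"
    have "(\<Sum>i\<in>I. ?d i *\<^sub>R v i x) = (\<Sum>i\<in>I. c i *\<^sub>R v i x)"
      by (rule sum.cong) (use insert.hyps in auto)
    then have "(\<Sum>i\<in>insert a I. ?d i *\<^sub>R v i x) = 0"
      using insert.hyps by (simp flip: c)
    from insert.prems(2)[OF x this] show False by simp
  qed
  have rc: "continuous_map X euclidean r"
    using insert.prems(1) ec unfolding continuous_map_euclidean_atin r_def[abs_def]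
    by (intro ballI tendsto_diff tendsto_sum tendsto_scaleR tendsto_inner) auto
  have "continuous_map X euclidean (e' i)" if "i \<in> insert a I" for i
  proof (cases "i = a")
    case True
    have "continuous_map X euclidean (\<lambda>x. r x /\<^sub>R norm (r x))"
      using rc r0 unfolding continuous_map_euclidean_atin
      by (intro ballI tendsto_scaleR tendsto_inverse tendsto_norm) auto
    then show ?thesis using True by (simp add: e'_def)
  next
    case False
    then show ?thesis using that ec by (simp add: e'_def)
  qed
  moreover have "orthonormal_on (insert a I) (\<lambda>i. e' i x)" if x: "x \<in> topspace X" for x
    unfolding orthonormal_on_def
  proof (intro ballI)
    fix i j assume ij: "i \<in> insert a I" "j \<in> insert a I"
    have aa: "e' a x \<bullet> e' a x = 1"
      using r0[OF x] by (simp add: e'_def dot_square_norm power2_eq_square)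
    have ab: "e' a x \<bullet> e' l x = 0" "e' l x \<bullet> e' a x = 0" if "l \<in> I" for l
      using ri[OF x that] insert.hyps(2) that by (auto simp: e'_def inner_commute[of "e l x"])
    have bb: "e' l x \<bullet> e' l' x = (if l = l' then 1 else 0)" if "l \<in> I" "l' \<in> I" for l l'
      using orthonormal_on_inner[OF eo[OF x] that] insert.hyps(2) that by (auto simp: e'_def)
    show "e' i x \<bullet> e' j x = (if i = j then 1 else 0)"
      using ij aa ab bb insert.hyps(2) by (cases "i = a"; cases "j = a") auto
  qed
  moreover have "e' i x \<in> span ((\<lambda>i. v i x) ` insert a I)" if "x \<in> topspace X" "i \<in> insert a I" for x i
  proof -
    have sub: "span ((\<lambda>i. v i x) ` I) \<subseteq> span ((\<lambda>i. v i x) ` insert a I)"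
      by (rule span_mono) blast
    have "r x \<in> span ((\<lambda>i. v i x) ` insert a I)"
      unfolding r_def
    proof (intro span_diff span_sum span_scale)
      show "v a x \<in> span ((\<lambda>i. v i x) ` insert a I)" by (rule span_base) simp
      show "e i x \<in> span ((\<lambda>i. v i x) ` insert a I)" if "i \<in> I" for i
        using es[OF \<open>x \<in> topspace X\<close> that] sub by blast
    qed
    then show ?thesis
      using es[OF that(1), of i] that(2) sub by (auto simp: e'_def intro: span_scale)
  qed
  ultimately show ?case by blast
qed

section \<open>Subspaces as projection matrices\<close>

text \<open>For a subspace \<open>L\<close> this is the orthogonal projection with kernel
  \<open>L\<close>, described by its values on \<open>L\<close> and on the complement. It replaces a
  point of the Grassmannian by a matrix, for which continuity can be computed.\<close>

definition is_cproj :: "(real^'n) set \<Rightarrow> real^'n^'n \<Rightarrow> bool" where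
  "is_cproj L A \<longleftrightarrow> (\<forall>x\<in>L. A *v x = 0) \<and> (\<forall>x. (\<forall>y\<in>L. x \<bullet> y = 0) \<longrightarrow> A *v x = x)"

definition cproj :: "(real^'n) set \<Rightarrow> real^'n^'n" where
  "cproj L = (SOME A. is_cproj L A)"

lemma subspace_orth_complement: "subspace {x. \<forall>y\<in>L. x \<bullet> y = 0}"
  by (auto simp: subspace_def inner_add_left)

lemma dim_orth_complement:
  fixes L :: "'a::euclidean_space set"
  assumes "subspace L"
  shows "dim {x. \<forall>y\<in>L. x \<bullet> y = 0} + dim L = DIM('a)"
  using dim_subspace_orthogonal_to_vectors[OF assms subspace_UNIV subset_UNIV]
  by (simp add: orthogonal_def inner_commute)

lemma orth_complement_decomp:
  fixes L :: "'a::euclidean_space set"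
  assumes "subspace L"
  obtains y z where "y \<in> L" "\<forall>l\<in>L. z \<bullet> l = 0" "x = y + z"
proof -
  obtain y z where "y \<in> span L" "\<And>l. l \<in> span L \<Longrightarrow> orthogonal z l" "x = y + z"
    using orthogonal_subspace_decomp_exists[of L x] by blast
  moreover have "span L = L" using assms by (simp only: span_eq_iff)
  ultimately show ?thesis using that[of y z] by (simp add: orthogonal_def)
qed

lemma is_cproj_apply:
  assumes "is_cproj L A" "y \<in> L" "\<forall>l\<in>L. z \<bullet> l = 0"
  shows "A *v (y + z) = z"
  using assms by (simp add: is_cproj_def matrix_vector_right_distrib)

lemma is_cproj_unique:
  fixes A B :: "real^'n^'n"
  assumes "subspace L" "is_cproj L A" "is_cproj L B"
  shows "A = B"
proof -
  have "A *v x = B *v x" for x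
  proof -
    obtain y z where "y \<in> L" "\<forall>l\<in>L. z \<bullet> l = 0" "x = y + z"
      by (rule orth_complement_decomp[OF assms(1)])
    then show ?thesis using is_cproj_apply assms(2,3) by metis
  qed
  then show ?thesis by (simp add: matrix_eq)
qed

lemma is_cproj_exists:
  fixes L :: "(real^'n) set"
  assumes L: "subspace L"
  shows "\<exists>A. is_cproj L A"
proof -
  let ?C = "{x. \<forall>y\<in>L. x \<bullet> y = 0}"
  obtain e :: "nat \<Rightarrow> real^'n" where e: "orthonormal_on {..<dim ?C} e" "span (e ` {..<dim ?C}) = ?C"
    by (rule subspace_orthonormal_basis[OF subspace_orth_complement finite_lessThan card_lessThan[symmetric]])
  define f where "f x = (\<Sum>j<dim ?C. (x \<bullet> e j) *\<^sub>R e j)" for x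
  have "linear f" unfolding f_def
    by (rule linear_compose_sum, rule ballI, rule linearI) (simp_all add: inner_add_left scaleR_add_left)
  moreover have "f x = 0" if "x \<in> L" for x
  proof -
    have "x \<bullet> e j = 0" if "j < dim ?C" for j
    proof -
      have "e j \<in> span (e ` {..<dim ?C})" using that by (intro span_base imageI) (simp only: lessThan_iff)
      then have "e j \<bullet> x = 0" unfolding e(2) using \<open>x \<in> L\<close> by blast
      then show ?thesis by (simp only: inner_commute)
    qed
    then show ?thesis by (simp add: f_def)
  qed
  moreover have "f x = x" if "\<forall>y\<in>L. x \<bullet> y = 0" for x
    unfolding f_def by (rule orthonormal_on_span_expand[OF e(1) finite_lessThan]) (simp only: e(2) mem_Collect_eq, rule that)
  ultimately have "is_cproj L (matrix f)"
    by (auto simp: is_cproj_def matrix_apply)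
  then show ?thesis by blast
qed

lemma cproj_is_cproj: "subspace L \<Longrightarrow> is_cproj L (cproj L)"
  unfolding cproj_def by (rule someI_ex) (rule is_cproj_exists)

lemma cproj_orthogonal:
  assumes "subspace L" "l \<in> L"
  shows "(cproj L *v x) \<bullet> l = 0"
proof -
  obtain y z where yz: "y \<in> L" "\<forall>l\<in>L. z \<bullet> l = 0" "x = y + z"
    by (rule orth_complement_decomp[OF assms(1)])
  then show ?thesis
    using is_cproj_apply[OF cproj_is_cproj[OF assms(1)] yz(1,2)] assms(2) by simp
qed

text \<open>Moving the subspace by \<open>g\<close> conjugates its projection. On the orthogonal
  group, \<open>cproj\<close> thus becomes a continuous expression in \<open>g\<close>, and
  continuity descends to the quotient.\<close>

lemma cproj_image:
  fixes g :: "real^'n^'n"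
  assumes L: "subspace L" and g: "orthogonal_matrix g"
  shows "cproj ((\<lambda>x. g *v x) ` L) = g ** cproj L ** transpose g"
proof (rule is_cproj_unique)
  show sub: "subspace ((\<lambda>x. g *v x) ` L)"
    by (rule linear_subspace_image[OF matrix_vector_mul_linear L])
  show "is_cproj ((\<lambda>x. g *v x) ` L) (cproj ((\<lambda>x. g *v x) ` L))"
    by (rule cproj_is_cproj[OF sub])
  have gg: "transpose g *v (g *v x) = x" "g *v (transpose g *v x) = x" for x
    using g by (simp_all add: matrix_vector_mul_assoc orthogonal_matrix_def)
  have ap: "(g ** cproj L ** transpose g) *v x = g *v (cproj L *v (transpose g *v x))" for x
    by (simp add: matrix_vector_mul_assoc matrix_mul_assoc)
  note c = cproj_is_cproj[OF L]
  show "is_cproj ((\<lambda>x. g *v x) ` L) (g ** cproj L ** transpose g)"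
    unfolding is_cproj_def ap
  proof (intro conjI allI impI ballI)
    fix x assume "x \<in> (\<lambda>x. g *v x) ` L"
    then show "g *v (cproj L *v (transpose g *v x)) = 0"
      using c by (auto simp: gg is_cproj_def)
  next
    fix x assume x: "\<forall>y\<in>(\<lambda>x. g *v x) ` L. x \<bullet> y = 0"
    have "\<forall>y\<in>L. (transpose g *v x) \<bullet> y = 0"
      using x by (simp add: inner_transpose)
    then have "cproj L *v (transpose g *v x) = transpose g *v x"
      using c by (simp add: is_cproj_def)
    then show "g *v (cproj L *v (transpose g *v x)) = x" by (simp add: gg)
  qed
qed

section \<open>Local frames over the Grassmannian\<close>

text \<open>One inclusion holds by orthogonality, and equal dimensions do the rest.\<close>

lemma orthonormal_on_complement_eq:
  fixes e :: "'i \<Rightarrow> 'a::euclidean_space"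
  assumes o: "orthonormal_on I e" and L: "subspace L" "dim L + card I = DIM('a)"
    and orth: "\<And>x i. x \<in> L \<Longrightarrow> i \<in> I \<Longrightarrow> x \<bullet> e i = 0"
  shows "{x. \<forall>i\<in>I. x \<bullet> e i = 0} = L"
proof (rule sym, rule subspace_dim_equal[OF L(1) orthogonal_complement_subspace])
  show "L \<subseteq> {x. \<forall>i\<in>I. x \<bullet> e i = 0}" using orth by blast
  show "dim {x. \<forall>i\<in>I. x \<bullet> e i = 0} \<le> dim L"
    using orthonormal_on_dim_complement[OF o] L(2) by simp
qed

lemma grass_image:
  fixes g :: "real^'n^'n"
  assumes "S \<in> grass m" "orthogonal_matrix g"
  shows "(\<lambda>x. g *v x) ` S \<in> grass m"
proof -
  have "inj (\<lambda>x. g *v x)"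
  proof (rule injI)
    fix x y assume "g *v x = g *v y"
    then have "transpose g *v (g *v x) = transpose g *v (g *v y)" by simp
    then show "x = y"
      using assms(2) by (simp add: matrix_vector_mul_assoc orthogonal_matrix)
  qed
  then have "dim ((\<lambda>x. g *v x) ` S) = dim S"
    by (intro dim_image_eq matrix_vector_mul_linear) (auto intro: inj_on_subset)
  moreover have "subspace ((\<lambda>x. g *v x) ` S)"
    by (rule linear_subspace_image[OF matrix_vector_mul_linear]) (use assms(1) in \<open>simp add: grass_def\<close>)
  ultimately show ?thesis using assms(1) by (simp add: grass_def)
qed

lemma some_grass:
  assumes "m \<le> CARD('n)"
  shows "(SOME S. S \<in> grass m) \<in> (grass m :: (real^'n) set set)"
proof -
  obtain S :: "(real^'n) set" where "subspace S" "dim S = m"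
    using choose_subspace_of_subspace[of m "UNIV :: (real^'n) set"] assms by auto
  then have "S \<in> grass m" by (simp add: grass_def)
  then show ?thesis by (rule someI[of "\<lambda>S. S \<in> grass m"])
qed

lemma topspace_grass_top:
  assumes "m \<le> CARD('n)" "L \<in> topspace (grass_top m :: (real^'n) set topology)"
  shows "L \<in> grass m"
  using assms(2) grass_image[OF some_grass[OF assms(1)]]
  by (auto simp: grass_top_def ortho_group_def)

lemma continuous_map_cproj:
  assumes "m \<le> CARD('n)"
  shows "continuous_map (grass_top m :: (real^'n) set topology) euclidean cproj"
  unfolding grass_top_def
proof (rule continuous_compose_quotient_map[OF quotient_map_quotient_topology])
  let ?S = "SOME S. S \<in> (grass m :: (real^'n) set set)"
  let ?O = "ortho_group :: (real^'n^'n) set"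
  have S: "subspace ?S" using some_grass[OF assms] by (simp add: grass_def)
  have "continuous_on ?O (\<lambda>g. g ** cproj ?S ** transpose g)"
    unfolding continuous_on_def by (intro ballI tendsto_matrix_mult tendsto_transpose tendsto_const tendsto_ident_at)
  then have "continuous_map (top_of_set ?O) euclidean (\<lambda>g. g ** cproj ?S ** transpose g)"
    by simp
  then show "continuous_map (top_of_set ?O) euclidean (cproj \<circ> (\<lambda>g. (\<lambda>x. g *v x) ` ?S))"
    by (rule continuous_map_eq) (simp add: cproj_image[OF S] ortho_group_def)
qed

lemma columns_transpose_mult_vector:
  "(transpose (\<chi> i j. e j $ i) *v x) $ j = x \<bullet> e j" for e :: "'m::finite \<Rightarrow> real^'n"
  by (simp add: matrix_vector_mult_def transpose_def inner_vec_def mult.commute)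

lemma columns_gram:
  fixes e :: "'m::finite \<Rightarrow> real^'n"
  assumes "orthonormal_on UNIV e"
  shows "transpose (\<chi> i j. e j $ i) ** (\<chi> i j. e j $ i) = mat 1"
  using orthonormal_on_inner[OF assms UNIV_I UNIV_I]
  by (simp add: vec_eq_iff matrix_matrix_mult_def transpose_def inner_vec_def mat_def)

text \<open>An orthonormal basis \<open>c\<close> of the complement of \<open>L1\<close> is
  projected to the complement of a nearby \<open>L\<close>. The projected vectors vary continuously
  and stay independent near \<open>L1\<close>, so Gram-Schmidt turns them into the columns of
  \<open>F L\<close>.\<close>

lemma local_frame:
  fixes L1 :: "(real^'n) set"
  assumes m: "CARD('m) + m = CARD('n)" and L1: "L1 \<in> topspace (grass_top m)"
  shows "\<exists>U (F :: (real^'n) set \<Rightarrow> real^'m::finite^'n). L1 \<in> U \<and> openin (grass_top m) U \<and>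
    continuous_map (subtopology (grass_top m) U) euclidean F \<and>
    (\<forall>L\<in>U. transpose (F L) ** F L = mat 1 \<and> {x. transpose (F L) *v x = 0} = L)"
proof -
  let ?G = "grass_top m :: (real^'n) set topology"
  have le: "m \<le> CARD('n)" using m by simp
  have sub: "subspace L" "dim L = m" if "L \<in> topspace ?G" for L
    using topspace_grass_top[OF le that] by (auto simp: grass_def)
  let ?C = "{x. \<forall>y\<in>L1. x \<bullet> y = 0}"
  have "dim ?C = card (UNIV :: 'm set)"
    using dim_orth_complement[OF sub(1)[OF L1]] sub(2)[OF L1] m by simp
  then obtain c :: "'m \<Rightarrow> real^'n" where c: "orthonormal_on UNIV c" "span (range c) = ?C"
    by (rule subspace_orthonormal_basis[OF subspace_orth_complement finite])
  define v where "v j L = cproj L *v c j" for j L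
  \<comment> \<open>The pairings of the fixed basis with its projections. At \<open>L1\<close> the
    projection changes nothing and this is the identity matrix, so a nonzero determinant marks out
    an open neighbourhood.\<close>
  define A :: "(real^'n) set \<Rightarrow> real^'m^'m" where "A L = (\<chi> i j. c i \<bullet> v j L)" for L
  define U where "U = {L \<in> topspace ?G. det (A L) \<in> - {0}}"
  have vc: "continuous_map ?G euclidean (v j)" for j
    using continuous_map_cproj[OF le] unfolding continuous_map_euclidean_atin v_def[abs_def] matrix_vector_mult_def
    by (intro ballI tendsto_vec_lambda tendsto_sum tendsto_mult tendsto_vec_nth tendsto_const) auto
  have "continuous_map ?G euclidean (\<lambda>L. det (A L))"
    using vc unfolding continuous_map_euclidean_atin det_def A_def
    by (intro ballI tendsto_vec_lambda tendsto_sum tendsto_mult tendsto_prod tendsto_const) (auto intro!: tendsto_inner)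
  then have oU: "openin ?G U"
    unfolding U_def by (rule openin_continuous_map_preimage) (simp add: open_Compl)
  have "v j L1 = c j" for j
  proof -
    have "c j \<in> ?C" unfolding c(2)[symmetric] by (rule span_base) simp
    then show ?thesis
      unfolding v_def using cproj_is_cproj[OF sub(1)[OF L1]] by (simp add: is_cproj_def)
  qed
  then have "A L1 = mat 1"
    unfolding A_def mat_def by (simp only: orthonormal_on_inner[OF c(1) UNIV_I UNIV_I])
  then have L1U: "L1 \<in> U" using L1 by (simp add: U_def)
  have UG: "U \<subseteq> topspace ?G" by (auto simp: U_def)
  let ?X = "subtopology ?G U"
  have topX: "topspace ?X = U" using UG by (simp add: Int_absorb1)
  \<comment> \<open>A relation among the projected vectors, paired with each \<open>c i\<close>,
    becomes a kernel vector of \<open>A L\<close>, which is invertible on \<open>U\<close>.\<close>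
  have indep: "\<forall>j\<in>UNIV. b j = 0" if L: "L \<in> topspace ?X" and z: "(\<Sum>j\<in>UNIV. b j *\<^sub>R v j L) = 0" for L and b :: "'m \<Rightarrow> real"
  proof -
    have "(A L *v (\<chi> j. b j)) $ i = c i \<bullet> (\<Sum>j\<in>UNIV. b j *\<^sub>R v j L)" for i
      by (simp add: A_def matrix_vector_mult_def inner_sum_right mult.commute)
    then have "A L *v (\<chi> j. b j) = 0" using z by (simp add: vec_eq_iff)
    moreover have "invertible (A L)" using L topX by (auto simp: U_def invertible_det_nz)
    ultimately have "(\<chi> j. b j) = 0"
      using matrix_left_invertible_ker[of "A L"] unfolding invertible_def by blast
    then show ?thesis by (simp add: vec_eq_iff)
  qed
  have "\<exists>e :: 'm \<Rightarrow> _. (\<forall>j\<in>UNIV. continuous_map ?X euclidean (e j)) \<and>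
      (\<forall>L\<in>topspace ?X. orthonormal_on UNIV (\<lambda>j. e j L) \<and> (\<forall>j\<in>UNIV. e j L \<in> span (range (\<lambda>j. v j L))))"
  proof (rule continuous_gram_schmidt[OF finite])
    show "continuous_map ?X euclidean (v j)" for j
      by (rule continuous_map_from_subtopology[OF vc])
  qed (rule indep)
  then obtain e :: "'m \<Rightarrow> _" where e: "(\<forall>j\<in>UNIV. continuous_map ?X euclidean (e j)) \<and>
      (\<forall>L\<in>topspace ?X. orthonormal_on UNIV (\<lambda>j. e j L) \<and> (\<forall>j\<in>UNIV. e j L \<in> span (range (\<lambda>j. v j L))))"
    by (rule exE)
  have ec: "continuous_map ?X euclidean (e j)" for j using e by simp
  have eo: "orthonormal_on UNIV (\<lambda>j. e j L)" and es: "e j L \<in> span (range (\<lambda>j. v j L))" if "L \<in> U" for L j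
    using e that unfolding topX by simp_all
  define F :: "(real^'n) set \<Rightarrow> real^'m^'n" where "F L = (\<chi> i j. e j L $ i)" for L
  have "continuous_map ?X euclidean F"
    using ec unfolding continuous_map_euclidean_atin F_def
    by (intro ballI tendsto_vec_lambda tendsto_vec_nth) auto
  moreover have "transpose (F L) ** F L = mat 1" if "L \<in> U" for L
    unfolding F_def by (rule columns_gram[OF eo[OF that]])
  moreover have "{x. transpose (F L) *v x = 0} = L" if L: "L \<in> U" for L
  proof -
    have LG: "L \<in> topspace ?G" using L UG by blast
    have "{x. transpose (F L) *v x = 0} = {x. \<forall>j\<in>UNIV. x \<bullet> e j L = 0}"
      by (simp add: vec_eq_iff F_def columns_transpose_mult_vector)
    also have "\<dots> = L"
    proof (rule orthonormal_on_complement_eq[OF eo[OF L] sub(1)[OF LG]])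
      show "dim L + card (UNIV :: 'm set) = DIM(real^'n)"
        using sub(2)[OF LG] m by simp
      fix x j assume x: "x \<in> L"
      show "x \<bullet> e j L = 0"
      proof (rule span_orthogonal[OF _ es[OF L]])
        fix y assume "y \<in> range (\<lambda>j. v j L)"
        then show "x \<bullet> y = 0"
          using cproj_orthogonal[OF sub(1)[OF LG] x] by (auto simp: v_def inner_commute)
      qed
    qed
    finally show ?thesis .
  qed
  ultimately show ?thesis using L1U oU by blast
qed

section \<open>The fibre bundle of rotations\<close>

definition fixed_space :: "real^'n^'n \<Rightarrow> (real^'n) set" where
  "fixed_space S = {x. S *v x = x}"

text \<open>When the columns of \<open>F\<close> are orthonormal, \<open>F ** transpose F\<close> is
  the projection onto the range of \<open>F\<close>; the sum is \<open>R\<close> transported to that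
  range and the identity on the kernel of \<open>transpose F\<close>.\<close>

definition inflate :: "real^'m^'n \<Rightarrow> real^'m^'m \<Rightarrow> real^'n^'n" where
  "inflate F R = mat 1 - F ** transpose F + F ** R ** transpose F"

lemma inflate_apply: "inflate F R *v x = x - F *v (transpose F *v x) + F *v (R *v (transpose F *v x))"
  by (simp add: inflate_def matrix_vector_mult_add_rdistrib matrix_vector_mult_diff_rdistrib
      matrix_vector_mul_assoc matrix_mul_assoc)

lemma isometry_inner:
  fixes F :: "real^'m^'n"
  assumes "transpose F ** F = mat 1"
  shows "(F *v x) \<bullet> (F *v y) = x \<bullet> y"
  using assms by (simp add: inner_transpose matrix_vector_mul_assoc)

lemma rotation_data_inflate:
  fixes F :: "real^'m^'n"
  assumes F: "transpose F ** F = mat 1" and d: "rotation_data R k \<theta> u w"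
  shows "rotation_data (inflate F R) k \<theta> (\<lambda>j. F *v u j) (\<lambda>j. F *v w j)"
proof -
  have FF: "transpose F *v (F *v x) = x" for x
    using F by (simp add: matrix_vector_mul_assoc)
  have ap: "inflate F R *v (F *v x) = F *v (R *v x)" for x
    by (simp add: inflate_apply FF)
  have "inflate F R *v x = x" if "\<forall>j<k. x \<bullet> (F *v u j) = 0 \<and> x \<bullet> (F *v w j) = 0" for x
  proof -
    have "\<forall>j<k. (transpose F *v x) \<bullet> u j = 0 \<and> (transpose F *v x) \<bullet> w j = 0"
      using that by (simp add: inner_transpose)
    then have "R *v (transpose F *v x) = transpose F *v x"
      using d unfolding rotation_data_def by blast
    then show ?thesis by (simp add: inflate_apply)
  qed
  then have fixed: "\<forall>x. (\<forall>j<k. x \<bullet> (F *v u j) = 0 \<and> x \<bullet> (F *v w j) = 0) \<longrightarrow> inflate F R *v x = x"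
    by blast
  have frame: "F *v (R *v u j) = cos (\<theta> j) *\<^sub>R (F *v u j) + sin (\<theta> j) *\<^sub>R (F *v w j)"
    "F *v (R *v w j) = (- sin (\<theta> j)) *\<^sub>R (F *v u j) + cos (\<theta> j) *\<^sub>R (F *v w j)" if "j < k" for j
  proof -
    have "R *v u j = cos (\<theta> j) *\<^sub>R u j + sin (\<theta> j) *\<^sub>R w j"
      "R *v w j = (- sin (\<theta> j)) *\<^sub>R u j + cos (\<theta> j) *\<^sub>R w j"
      using d that unfolding rotation_data_def by blast+
    then show "F *v (R *v u j) = cos (\<theta> j) *\<^sub>R (F *v u j) + sin (\<theta> j) *\<^sub>R (F *v w j)"
      "F *v (R *v w j) = (- sin (\<theta> j)) *\<^sub>R (F *v u j) + cos (\<theta> j) *\<^sub>R (F *v w j)"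
      by (simp_all only: matrix_vector_right_distrib matrix_vector_mult_scaleR)
  qed
  show ?thesis
    unfolding rotation_data_def isometry_inner[OF F] ap
  proof (rule conjI[OF _ conjI])
    show "\<forall>j<k. 0 < \<theta> j \<and> \<theta> j \<le> pi \<and>
        F *v (R *v u j) = cos (\<theta> j) *\<^sub>R (F *v u j) + sin (\<theta> j) *\<^sub>R (F *v w j) \<and>
        F *v (R *v w j) = (- sin (\<theta> j)) *\<^sub>R (F *v u j) + cos (\<theta> j) *\<^sub>R (F *v w j)"
      using frame d unfolding rotation_data_def by simp
  qed (rule d[unfolded rotation_data_def, THEN conjunct1], rule fixed)
qed

lemma compress_inflate:
  fixes F :: "real^'m^'n"
  assumes F: "transpose F ** F = mat 1"
  shows "transpose F ** inflate F R ** F = R"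
proof -
  have FF: "transpose F *v (F *v x) = x" for x
    using F by (simp add: matrix_vector_mul_assoc)
  have "(transpose F ** inflate F R ** F) *v x = transpose F *v (inflate F R *v (F *v x))" for x
    by (simp only: matrix_vector_mul_assoc matrix_mul_assoc)
  also have "\<dots> x = R *v x" for x
    by (simp add: inflate_apply FF)
  finally show ?thesis by (simp add: matrix_eq)
qed

text \<open>In dimension \<open>2 * k\<close> the planes of \<open>R\<close> fill the space, so
  \<open>R\<close> fixes only 0 and the fixed vectors of the inflated matrix are those that
  \<open>transpose F\<close> kills.\<close>

lemma fixed_space_inflate:
  fixes F :: "real^'m^'n"
  assumes F: "transpose F ** F = mat 1" and d: "rotation_data R k \<theta> u w" and card: "CARD('m) = 2 * k"
  shows "fixed_space (inflate F R) = {x. transpose F *v x = 0}"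
proof -
  have "inflate F R *v x = x \<longleftrightarrow> transpose F *v x = 0" for x
  proof -
    have "inflate F R *v x = x \<longleftrightarrow> (\<forall>j<k. (transpose F *v x) \<bullet> u j = 0 \<and> (transpose F *v x) \<bullet> w j = 0)"
      unfolding rotation_data_fixed_iff[OF rotation_data_inflate[OF F d]]
      by (simp add: inner_transpose)
    also have "\<dots> \<longleftrightarrow> transpose F *v x = 0"
    proof
      assume *: "\<forall>j<k. (transpose F *v x) \<bullet> u j = 0 \<and> (transpose F *v x) \<bullet> w j = 0"
      show "transpose F *v x = 0"
        by (rule orthonormal_on_full[OF rotation_data_orthonormal_on[OF d]])
           (use * card in \<open>auto simp: card_cartesian_product frame_def\<close>)
    qed simp
    finally show ?thesis .
  qed
  then show ?thesis by (simp add: fixed_space_def)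
qed

text \<open>The residual is killed by \<open>transpose F\<close>; it is therefore orthogonal to
  \<open>v\<close> by assumption and to the range of \<open>F\<close> by adjointness, hence to
  itself.\<close>

lemma isometry_range:
  fixes F :: "real^'m^'n"
  assumes F: "transpose F ** F = mat 1" and v: "\<And>x. transpose F *v x = 0 \<Longrightarrow> v \<bullet> x = 0"
  shows "F *v (transpose F *v v) = v"
proof -
  let ?r = "v - F *v (transpose F *v v)"
  have r: "transpose F *v ?r = 0"
    using F by (simp add: matrix_vector_mult_diff_distrib matrix_vector_mul_assoc matrix_mul_assoc)
  have "?r \<bullet> ?r = v \<bullet> ?r - (F *v (transpose F *v v)) \<bullet> ?r" by (rule inner_diff_left)
  also have "\<dots> = 0" using v[OF r] r by (simp only: inner_transpose[of F]) simp
  finally have "?r = 0" by (simp only: inner_eq_zero_iff)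
  then show ?thesis by (simp only: right_minus_eq)
qed

text \<open>The planes of \<open>S\<close> are orthogonal to its fixed space, the kernel of
  \<open>transpose F\<close>, so they lie in the range of \<open>F\<close>. There
  \<open>F ** transpose F\<close> acts as the identity and \<open>transpose F\<close> preserves
  inner products.\<close>

lemma rotation_data_compress:
  fixes F :: "real^'m^'n"
  assumes F: "transpose F ** F = mat 1" and d: "rotation_data S k \<theta> u w"
    and fixS: "fixed_space S = {x. transpose F *v x = 0}"
  shows "rotation_data (transpose F ** S ** F) k \<theta> (\<lambda>j. transpose F *v u j) (\<lambda>j. transpose F *v w j)"
    "inflate F (transpose F ** S ** F) = S"
proof -
  let ?R = "transpose F ** S ** F"
  have FF: "transpose F *v (F *v x) = x" for x
    using F by (simp add: matrix_vector_mul_assoc)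
  have ap: "?R *v x = transpose F *v (S *v (F *v x))" for x
    by (simp only: matrix_vector_mul_assoc matrix_mul_assoc)
  have orth: "x \<bullet> u j = 0" "x \<bullet> w j = 0" if "transpose F *v x = 0" "j < k" for x j
  proof -
    have "S *v x = x" using fixS that(1) unfolding fixed_space_def by blast
    then show "x \<bullet> u j = 0" "x \<bullet> w j = 0"
      using rotation_data_fixed_iff[OF d, of x] that(2) by auto
  qed
  have uw: "F *v (transpose F *v u j) = u j" "F *v (transpose F *v w j) = w j" if "j < k" for j
    using orth that by (auto intro!: isometry_range[OF F] simp: inner_commute)
  have inn: "(transpose F *v x) \<bullet> (transpose F *v y) = x \<bullet> y" if "F *v (transpose F *v x) = x" for x y
    using that by (metis inner_transpose)
  have "?R *v x = x" if "\<forall>j<k. x \<bullet> (transpose F *v u j) = 0 \<and> x \<bullet> (transpose F *v w j) = 0" for x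
  proof -
    have "S *v (F *v x) = F *v x"
      using that unfolding rotation_data_fixed_iff[OF d] by (simp add: inner_transpose)
    then show ?thesis by (simp add: ap FF)
  qed
  then have fixed: "\<forall>x. (\<forall>j<k. x \<bullet> (transpose F *v u j) = 0 \<and> x \<bullet> (transpose F *v w j) = 0) \<longrightarrow> ?R *v x = x"
    by blast
  have frame: "?R *v (transpose F *v u j) = cos (\<theta> j) *\<^sub>R (transpose F *v u j) + sin (\<theta> j) *\<^sub>R (transpose F *v w j)"
    "?R *v (transpose F *v w j) = (- sin (\<theta> j)) *\<^sub>R (transpose F *v u j) + cos (\<theta> j) *\<^sub>R (transpose F *v w j)"
    if "j < k" for j
  proof -
    have S: "S *v u j = cos (\<theta> j) *\<^sub>R u j + sin (\<theta> j) *\<^sub>R w j"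
      "S *v w j = (- sin (\<theta> j)) *\<^sub>R u j + cos (\<theta> j) *\<^sub>R w j"
      using d that unfolding rotation_data_def by blast+
    show "?R *v (transpose F *v u j) = cos (\<theta> j) *\<^sub>R (transpose F *v u j) + sin (\<theta> j) *\<^sub>R (transpose F *v w j)"
      "?R *v (transpose F *v w j) = (- sin (\<theta> j)) *\<^sub>R (transpose F *v u j) + cos (\<theta> j) *\<^sub>R (transpose F *v w j)"
      by (simp_all only: ap uw[OF that] S matrix_vector_right_distrib matrix_vector_mult_scaleR)
  qed
  show data: "rotation_data ?R k \<theta> (\<lambda>j. transpose F *v u j) (\<lambda>j. transpose F *v w j)"
    unfolding rotation_data_def
  proof (rule conjI[OF _ conjI])
    show "\<forall>i<k. \<forall>j<k. (transpose F *v u i) \<bullet> (transpose F *v u j) = (if i = j then 1 else 0) \<and>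
        (transpose F *v w i) \<bullet> (transpose F *v w j) = (if i = j then 1 else 0) \<and>
        (transpose F *v u i) \<bullet> (transpose F *v w j) = 0"
      using inn uw rotation_data_orthonormal[OF d] by simp
    show "\<forall>j<k. 0 < \<theta> j \<and> \<theta> j \<le> pi \<and>
        ?R *v (transpose F *v u j) = cos (\<theta> j) *\<^sub>R (transpose F *v u j) + sin (\<theta> j) *\<^sub>R (transpose F *v w j) \<and>
        ?R *v (transpose F *v w j) = (- sin (\<theta> j)) *\<^sub>R (transpose F *v u j) + cos (\<theta> j) *\<^sub>R (transpose F *v w j)"
      using frame d unfolding rotation_data_def by simp
  qed (rule fixed)
  \<comment> \<open>Inflating the compressed data returns the original frame, and equal data give
    equal matrices.\<close>
  have "inflate F ?R *v x = S *v x" for x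
    unfolding rotation_data_apply[OF rotation_data_inflate[OF F data]] rotation_data_apply[OF d]
    by (rule rot_cong) (simp_all only: uw)
  then show "inflate F ?R = S" by (simp add: matrix_eq)
qed

text \<open>Any rotation \<open>T'\<close> with the same angles on a space of dimension
  \<open>2 * k\<close> may represent the fibre, since its class is described by the angles
  alone.\<close>

theorem conj_class_fibre_bundle:
  fixes T :: "real^'n^'n" and T' :: "real^'m^'m"
  assumes T: "k_rotation_with_angles T k \<theta>" and n: "CARD('n) > 2 * k"
    and T': "k_rotation_with_angles T' k \<theta>" and m: "CARD('m) = 2 * k"
  shows "fibre_bundle (top_of_set (conj_class T)) (grass_top (CARD('n) - 2 * k) :: (real^'n) set topology)
    (top_of_set (conj_class T')) fixed_space"
proof -
  let ?O = "ortho_group :: (real^'n^'n) set"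
  let ?l = "CARD('n) - 2 * k"
  let ?G = "grass_top ?l :: (real^'n) set topology"
  let ?E = "top_of_set (conj_class T)"
  have rng: "0 < \<theta> j \<and> \<theta> j \<le> pi" if "j < k" for j
    using T that unfolding k_rotation_with_angles_def rotation_data_def by blast
  define S0 :: "(real^'n) set" where "S0 = (SOME S. S \<in> grass ?l)"
  have "S0 \<in> grass ?l" unfolding S0_def by (rule some_grass) simp
  then have S0: "subspace S0" "dim S0 = ?l" by (auto simp: grass_def)
  let ?I = "{..<k} \<times> (UNIV :: bool set)"
  let ?C = "{x. \<forall>y\<in>S0. x \<bullet> y = 0}"
  have cI: "card ?I = 2 * k" by (simp add: card_cartesian_product)
  have dC: "dim ?C = card ?I"
    using dim_orth_complement[OF S0(1)] S0(2) n cI by simp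
  have "finite ?I" by simp
  then obtain e :: "nat \<times> bool \<Rightarrow> real^'n" where e: "orthonormal_on ?I e" "span (e ` ?I) = ?C"
    by (rule subspace_orthonormal_basis[OF subspace_orth_complement _ dC])
  define u w where "u j = e (j, False)" and "w j = e (j, True)" for j
  have fr: "frame u w p = e p" for p by (cases p) (simp add: frame_def u_def w_def)
  have o: "orthonormal_on ?I (frame u w)" using e(1) by (simp add: orthonormal_on_def fr)
  \<comment> \<open>Its planes fill the complement of the chosen subspace \<open>S0\<close>, so its
    fixed space is \<open>S0\<close> itself.\<close>
  define T0 where "T0 = matrix (rot k \<theta> u w)"
  have data0: "rotation_data T0 k \<theta> u w"
    unfolding T0_def by (rule rotation_data_rot[OF o rng])
  then have T0: "k_rotation_with_angles T0 k \<theta>"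
    by (auto simp: k_rotation_with_angles_def)
  have cc: "conj_class T = conj_class T0"
    unfolding conj_class_eq[OF T] conj_class_eq[OF T0] ..
  have "{x. \<forall>p\<in>?I. x \<bullet> e p = 0} = S0"
  proof (rule orthonormal_on_complement_eq[OF e(1) S0(1)])
    show "dim S0 + card ?I = DIM(real^'n)" using S0(2) cI n by simp
    fix x p assume xp: "x \<in> S0" "p \<in> ?I"
    have "e p \<in> span (e ` ?I)" by (intro span_base imageI xp)
    then have "e p \<bullet> x = 0" unfolding e(2) using xp(1) by blast
    then show "x \<bullet> e p = 0" by (simp only: inner_commute)
  qed
  moreover have "fixed_space T0 = {x. \<forall>p\<in>?I. x \<bullet> e p = 0}"
    unfolding fixed_space_def rotation_data_fixed_iff[OF data0]
    by (auto simp: u_def w_def) (metis (full_types))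
  ultimately have fix0: "fixed_space T0 = S0" by simp
  define \<pi> :: "real^'n^'n \<Rightarrow> (real^'n) set" where "\<pi> g = (\<lambda>x. g *v x) ` S0" for g
  have top: "?G = quotient_topology (top_of_set ?O) \<pi>"
    unfolding grass_top_def \<pi>_def[abs_def] S0_def ..
  have p: "fixed_space (g ** T0 ** transpose g) = \<pi> g" if "g \<in> ?O" for g
  proof -
    have gg: "transpose g *v (g *v x) = x" "g *v (transpose g *v x) = x" for x
      using that by (simp_all add: ortho_group_def matrix_vector_mul_assoc orthogonal_matrix_def)
    have ap: "(g ** T0 ** transpose g) *v x = g *v (T0 *v (transpose g *v x))" for x
      by (simp add: matrix_vector_mul_assoc matrix_mul_assoc)
    show ?thesis
      unfolding \<pi>_def fix0[symmetric] fixed_space_def ap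
    proof (intro equalityI subsetI)
      fix x assume "x \<in> {x. g *v (T0 *v (transpose g *v x)) = x}"
      then have "transpose g *v (g *v (T0 *v (transpose g *v x))) = transpose g *v x" by simp
      then have "transpose g *v x \<in> {x. T0 *v x = x}" by (simp add: gg)
      then show "x \<in> (\<lambda>x. g *v x) ` {x. T0 *v x = x}"
        by (intro image_eqI[of _ _ "transpose g *v x"]) (simp_all only: gg)
    qed (auto simp: gg)
  qed
  have cont: "continuous_map ?E ?G fixed_space"
    unfolding cc top by (rule orbit_map_continuous(1)[of fixed_space T0 \<pi>, OF p])
  have surj: "fixed_space ` topspace ?E = topspace ?G"
    unfolding cc top using orbit_map_continuous(2)[of fixed_space T0 \<pi>, OF p] by simp
  show ?thesis
    unfolding fibre_bundle_def
  proof (intro conjI ballI cont surj)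
    fix b assume b: "b \<in> topspace ?G"
    have ml: "CARD('m) + ?l = CARD('n)" using m n by simp
    obtain U and F :: "(real^'n) set \<Rightarrow> real^'m^'n" where bU: "b \<in> U" and oU: "openin ?G U"
      and Fc: "continuous_map (subtopology ?G U) euclidean F"
      and F1: "\<And>L. L \<in> U \<Longrightarrow> transpose (F L) ** F L = mat 1"
      and F2: "\<And>L. L \<in> U \<Longrightarrow> {x. transpose (F L) *v x = 0} = L"
      using local_frame[OF ml b] by blast
    have UG: "U \<subseteq> topspace ?G" using oU by (rule openin_subset)
    let ?P = "{x \<in> topspace ?E. fixed_space x \<in> U}"
    let ?X = "subtopology ?E ?P" and ?B = "subtopology ?G U" and ?K = "top_of_set (conj_class T')"
    \<comment> \<open>\<open>F\<close> is evaluated at the fixed space of \<open>S\<close>, so one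
      formula compresses every rotation over \<open>U\<close> to the same model space.\<close>
    define \<phi> where "\<phi> S = (fixed_space S, transpose (F (fixed_space S)) ** S ** F (fixed_space S))" for S
    define \<psi> where "\<psi> = (\<lambda>(L, R). inflate (F L) R)"
    have topX: "topspace ?X = {S \<in> conj_class T. fixed_space S \<in> U}" by auto
    have topB: "topspace ?B = U" using UG by (simp add: Int_absorb1)
    have comp: "k_rotation_with_angles (transpose (F (fixed_space S)) ** S ** F (fixed_space S)) k \<theta>"
      "inflate (F (fixed_space S)) (transpose (F (fixed_space S)) ** S ** F (fixed_space S)) = S"
      if S: "S \<in> conj_class T" "fixed_space S \<in> U" for S
    proof -
      obtain u w where d: "rotation_data S k \<theta> u w"
        using S(1) unfolding conj_class_eq[OF T] by (auto simp: k_rotation_with_angles_def)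
      note c = rotation_data_compress[OF F1[OF S(2)] d F2[OF S(2), symmetric]]
      show "k_rotation_with_angles (transpose (F (fixed_space S)) ** S ** F (fixed_space S)) k \<theta>"
        unfolding k_rotation_with_angles_def using c(1) by blast
      show "inflate (F (fixed_space S)) (transpose (F (fixed_space S)) ** S ** F (fixed_space S)) = S"
        by (rule c(2))
    qed
    have infl: "k_rotation_with_angles (inflate (F L) R) k \<theta>" "fixed_space (inflate (F L) R) = L"
      if L: "L \<in> U" and R: "R \<in> conj_class T'" for L R
    proof -
      obtain u w where d: "rotation_data R k \<theta> u w"
        using R unfolding conj_class_eq[OF T'] by (auto simp: k_rotation_with_angles_def)
      show "k_rotation_with_angles (inflate (F L) R) k \<theta>"
        unfolding k_rotation_with_angles_def using rotation_data_inflate[OF F1[OF L] d] by blast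
      show "fixed_space (inflate (F L) R) = L"
        using fixed_space_inflate[OF F1[OF L] d m] F2[OF L] by simp
    qed
    have fX: "continuous_map ?X ?B fixed_space"
      by (intro continuous_map_into_subtopology continuous_map_from_subtopology cont) auto
    have idX: "continuous_map ?X euclidean (\<lambda>S. S)"
      by (intro continuous_map_from_subtopology) simp
    have FX: "continuous_map ?X euclidean (\<lambda>S. F (fixed_space S))"
      using continuous_map_compose[OF fX Fc] by (simp add: o_def)
    have "homeomorphic_maps ?X (prod_topology ?B ?K) \<phi> \<psi>"
      unfolding homeomorphic_maps_def
    proof (intro conjI ballI)
      have "continuous_map ?X ?K (\<lambda>S. transpose (F (fixed_space S)) ** S ** F (fixed_space S))"
      proof (rule continuous_map_into_subtopology)
        show "continuous_map ?X euclidean (\<lambda>S. transpose (F (fixed_space S)) ** S ** F (fixed_space S))"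
          by (intro continuous_map_matrix_mult continuous_map_transpose FX idX)
        show "(\<lambda>S. transpose (F (fixed_space S)) ** S ** F (fixed_space S)) \<in> topspace ?X \<rightarrow> conj_class T'"
          unfolding topX conj_class_eq[OF T'] using comp(1) by blast
      qed
      then show "continuous_map ?X (prod_topology ?B ?K) \<phi>"
        unfolding \<phi>_def[abs_def] by (intro continuous_map_pairedI fX)
      let ?Z = "prod_topology ?B ?K"
      have FZ: "continuous_map ?Z euclidean (\<lambda>z. F (fst z))"
        using continuous_map_compose[OF continuous_map_fst Fc] by (simp add: o_def)
      have RZ: "continuous_map ?Z euclidean (\<lambda>z. snd z)"
        using continuous_map_snd[of ?B ?K] by (simp add: continuous_map_in_subtopology)
      have "continuous_map ?Z euclidean (\<lambda>z. inflate (F (fst z)) (snd z))"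
        unfolding inflate_def
        by (intro continuous_map_add continuous_map_diff continuous_map_matrix_mult continuous_map_transpose FZ RZ continuous_map_const[THEN iffD2]) auto
      moreover have "inflate (F (fst z)) (snd z) \<in> {S \<in> conj_class T. fixed_space S \<in> U}" if "z \<in> topspace ?Z" for z
      proof -
        have "fst z \<in> U" "snd z \<in> conj_class T'" using that topB by (auto simp: mem_Times_iff)
        then show ?thesis unfolding conj_class_eq[OF T] using infl by simp
      qed
      ultimately show "continuous_map ?Z ?X \<psi>"
        unfolding \<psi>_def case_prod_unfold
        by (intro continuous_map_into_subtopology) auto
      show "\<psi> (\<phi> S) = S" if "S \<in> topspace ?X" for S
        using comp(2) that unfolding topX by (simp add: \<phi>_def \<psi>_def)
      show "\<phi> (\<psi> z) = z" if "z \<in> topspace ?Z" for z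
      proof -
        have z: "fst z \<in> U" "snd z \<in> conj_class T'"
          using that topB by (auto simp: mem_Times_iff)
        have "\<phi> (\<psi> z) = (fst z, snd z)"
          unfolding \<psi>_def \<phi>_def case_prod_unfold infl(2)[OF z] compress_inflate[OF F1[OF z(1)]] ..
        then show ?thesis by simp
      qed
    qed
    then have "homeomorphic_map ?X (prod_topology ?B ?K) \<phi>"
      by (rule homeomorphic_maps_imp_map)
    moreover have "\<forall>x\<in>topspace ?E. fixed_space x \<in> U \<longrightarrow> fst (\<phi> x) = fixed_space x"
      by (simp add: \<phi>_def)
    ultimately show "\<exists>U \<phi>. b \<in> U \<and> openin ?G U \<and>
        homeomorphic_map (subtopology ?E {x \<in> topspace ?E. fixed_space x \<in> U}) (prod_topology (subtopology ?G U) ?K) \<phi> \<and>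
        (\<forall>x\<in>topspace ?E. fixed_space x \<in> U \<longrightarrow> fst (\<phi> x) = fixed_space x)"
      using bU oU by blast
  qed
qed

theorem theorem1p4:
  fixes T :: "real^'n^'n" and k :: nat and \<theta> :: "nat \<Rightarrow> real"
  assumes "k_rotation_with_angles T k \<theta>"
    and "inj_on \<theta> {..<k}"
  shows "(CARD('n) = 2 * k \<longrightarrow>
           (\<exists>p. sheeted_covering (d0 k \<theta>) (top_of_set (conj_class T))
                  (dfrak_top k :: (real^'n) set set topology) p))
       \<and> (CARD('n) > 2 * k \<longrightarrow>
           (\<forall>T' :: real^'m^'m. CARD('m) = 2 * k \<and> k_rotation_with_angles T' k \<theta> \<longrightarrow>
              (\<exists>p. fibre_bundle (top_of_set (conj_class T))
                     (grass_top (CARD('n) - 2 * k) :: (real^'n) set topology)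
                     (top_of_set (conj_class T')) p)))"
  using conj_class_covering[OF assms] conj_class_fibre_bundle[OF assms(1)] by blast

end
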